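(* Let $(N,\vdash,\dashv)$ be a Novikov dialgebra over a field $\Bbbk$. Then $N$ embeds into a differential Perm-algebra $(P,d)$ in such a way that $x\vdash y = x\,d(y)$ and $x\dashv y = d(y)\,x$ for all $x,y\in N$; that is, there exist a Perm-algebra $P$ with a derivation $d$ and an injective linear map $\theta: N\to P$ such that $\theta(x\vdash y)=\theta(x)d(\theta(y))$ and $\theta(x\dashv y)=d(\theta(y))\theta(x)$ for all $x,y\in N$.
   Context: $\Bbbk$ is an arbitrary field. A Perm-algebra is an associative (not necessarily unital) algebra satisfying $xyz=yxz$. A differential Perm-algebra is a pair $(P,d)$ with $P$ a Perm-algebra and $d$ a derivation of $P$ (a linear map with $d(xy)=d(x)y+xd(y)$). A Novikov dialgebra is a linear space $N$ with two bilinear operations $\vdash,\dashv$ such that for all $x_1,x_2,x_3\in N$: (0-identities) $(x_1\dashv x_2)\vdash x_3=(x_1\vdash x_2)\vdash x_3$, $\; x_1\dashv(x_2\vdash x_3)=x_1\dashv(x_2\dashv x_3)$; (left symmetry) $(x_1\dashv x_2)\dashv x_3-x_1\dashv(x_2\dashv x_3)=(x_2\vdash x_1)\dashv x_3-x_2\vdash(x_1\dashv x_3)$, $\;(x_1\vdash x_2)\vdash x_3-x_1\vdash(x_2\vdash x_3)=(x_2\vdash x_1)\vdash x_3-x_2\vdash(x_1\vdash x_3)$; (right commutativity) $(x_1\dashv x_2)\dashv x_3=(x_1\dashv x_3)\dashv x_2$, $\;(x_1\vdash x_2)\dashv x_3=(x_1\vdash x_3)\vdash x_2$. *)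

theory Defs
  imports Complex_Main "HOL-Library.Poly_Mapping"
begin

definition bilinear_op ::
    "('k::field \<Rightarrow> 'a::ab_group_add \<Rightarrow> 'a) \<Rightarrow> ('a \<Rightarrow> 'a \<Rightarrow> 'a) \<Rightarrow> bool" where
  "bilinear_op scale f \<longleftrightarrow>
     (\<forall>x. Vector_Spaces.linear scale scale (\<lambda>y. f x y)) \<and>
     (\<forall>y. Vector_Spaces.linear scale scale (\<lambda>x. f x y))"

locale novikov_dialgebra = vector_space scale
  for scale :: "'k::field \<Rightarrow> 'n::ab_group_add \<Rightarrow> 'n" +
  fixes vdash :: "'n \<Rightarrow> 'n \<Rightarrow> 'n" (infixl \<open>\<turnstile>\<close> 70)
    and dashv :: "'n \<Rightarrow> 'n \<Rightarrow> 'n" (infixl \<open>\<stileturn>\<close> 70)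
  assumes bilinear_vdash: "bilinear_op scale (\<turnstile>)"
    and bilinear_dashv: "bilinear_op scale (\<stileturn>)"
    and zero_vdash: "(x\<^sub>1 \<stileturn> x\<^sub>2) \<turnstile> x\<^sub>3 = (x\<^sub>1 \<turnstile> x\<^sub>2) \<turnstile> x\<^sub>3"
    and zero_dashv: "x\<^sub>1 \<stileturn> (x\<^sub>2 \<turnstile> x\<^sub>3) = x\<^sub>1 \<stileturn> (x\<^sub>2 \<stileturn> x\<^sub>3)"
    and left_symmetric_dashv:
      "(x\<^sub>1 \<stileturn> x\<^sub>2) \<stileturn> x\<^sub>3 - x\<^sub>1 \<stileturn> (x\<^sub>2 \<stileturn> x\<^sub>3) = (x\<^sub>2 \<turnstile> x\<^sub>1) \<stileturn> x\<^sub>3 - x\<^sub>2 \<turnstile> (x\<^sub>1 \<stileturn> x\<^sub>3)"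
    and left_symmetric_vdash:
      "(x\<^sub>1 \<turnstile> x\<^sub>2) \<turnstile> x\<^sub>3 - x\<^sub>1 \<turnstile> (x\<^sub>2 \<turnstile> x\<^sub>3) = (x\<^sub>2 \<turnstile> x\<^sub>1) \<turnstile> x\<^sub>3 - x\<^sub>2 \<turnstile> (x\<^sub>1 \<turnstile> x\<^sub>3)"
    and right_commutative_dashv: "(x\<^sub>1 \<stileturn> x\<^sub>2) \<stileturn> x\<^sub>3 = (x\<^sub>1 \<stileturn> x\<^sub>3) \<stileturn> x\<^sub>2"
    and right_commutative_vdash: "(x\<^sub>1 \<turnstile> x\<^sub>2) \<stileturn> x\<^sub>3 = (x\<^sub>1 \<turnstile> x\<^sub>3) \<turnstile> x\<^sub>2"

locale perm_algebra = vector_space scale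
  for scale :: "'k::field \<Rightarrow> 'p::ab_group_add \<Rightarrow> 'p" +
  fixes mult :: "'p \<Rightarrow> 'p \<Rightarrow> 'p" (infixl \<open>\<cdot>\<close> 70)
  assumes bilinear_mult: "bilinear_op scale (\<cdot>)"
    and assoc: "(x \<cdot> y) \<cdot> z = x \<cdot> (y \<cdot> z)"
    and perm: "(x \<cdot> y) \<cdot> z = (y \<cdot> x) \<cdot> z"

locale differential_perm_algebra = perm_algebra scale mult
  for scale :: "'k::field \<Rightarrow> 'p::ab_group_add \<Rightarrow> 'p"
    and mult :: "'p \<Rightarrow> 'p \<Rightarrow> 'p" (infixl \<open>\<cdot>\<close> 70) +
  fixes d :: "'p \<Rightarrow> 'p"
  assumes linear_d: "Vector_Spaces.linear scale scale d"
    and derivation: "d (x \<cdot> y) = d x \<cdot> y + x \<cdot> d y"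

text \<open>
  HOL cannot quantify existentially over types, so the Perm-algebra asserted to exist must live on
  a type fixed in advance. The type below is the underlying group of the free associative algebra
  on symbols \<open>(i, x)\<close>, to be thought of as the \<open>i\<close>-th derivative of \<open>x\<close>; the multiplication on it
  is not fixed.

  This loses no generality. Suppose \<open>\<theta>\<close> embeds \<open>'n\<close> into any differential Perm-algebra, and let
  \<open>P\<close> be the differential subalgebra generated by the image of \<open>\<theta>\<close>. Then \<open>P\<close> is spanned by the
  products of elements \<open>d\<^sup>i (\<theta> x)\<close>, so there is a linear surjection \<open>q\<close> from this space onto \<open>P\<close>;
  let \<open>s\<close> be a linear section of it. The operations \<open>u \<cdot> v = s (q u \<cdot> q v)\<close> and
  \<open>d u = s (d (q u))\<close> make the whole space a differential Perm-algebra, into which \<open>s \<circ> \<theta>\<close> embeds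
  \<open>'n\<close> with the same identities.
\<close>
type_synonym ('n, 'k) envelope = "(nat \<times> 'n) list \<Rightarrow>\<^sub>0 'k"

end

theory Submission
  imports Defs "HOL-Library.Multiset" "HOL-Library.Product_Plus"
begin

text \<open>
  For a Novikov algebra \<open>N\<close> call a linear map right linear if it commutes with all right
  multiplications, and consider symmetric \<open>p\<close>-linear maps \<open>F : N\<^sup>p \<rightarrow> N\<close> that commute with all right
  linear maps in every argument and whose derivative (below) is symmetric as well. They model the
  elements of weight \<open>p - 1\<close> of a differential envelope: such an element \<open>u\<close> acts by
  \<open>F(x\<^sub>1, \<dots>, x\<^sub>p) = u x\<^sub>1 \<cdots> x\<^sub>p\<close>. Multiplication becomes insertion of one map into another, which is
  commutative by right linearity, and the derivative of \<open>F\<close> is the map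
  \<open>(z, x\<^sub>1, \<dots>, x\<^sub>p) \<mapsto> z \<circ> F(x\<^sub>1, \<dots>, x\<^sub>p) - \<Sum>\<^sub>i F(\<dots>, z \<circ> x\<^sub>i, \<dots>)\<close>. Its first argument acts like
  an element of the commutator Lie algebra of \<open>N\<close>, and this is what makes the second derivative
  symmetric. Take the polynomial ring on all these maps modulo the relations identifying the product
  of \<open>F\<close> (of degree \<open>p \<ge> 1\<close>) and \<open>G\<close> with the insertion of \<open>G\<close> into \<open>F\<close>. The derivative descends
  to it, and evaluating the product of the letters of positive degree at the letters of degree \<open>0\<close>,
  which are elements of \<open>N\<close>, shows that \<open>N\<close> survives in the quotient.

  For a Novikov dialgebra \<open>N\<close>, apply this to the split null extension \<open>N\<^sub>0 \<oplus> N\<close>, where \<open>N\<^sub>0\<close> is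
  the quotient identifying \<open>\<turnstile>\<close> and \<open>\<stileturn>\<close>. If \<open>j\<close> embeds it into a differential commutative
  algebra \<open>C\<close>, then \<open>C \<times> C\<close> with \<open>(f, g)(f', g') = (f f', f g')\<close> is a Perm-algebra and
  \<open>x \<mapsto> (j(x\<^sub>0, 0), j(0, x))\<close> is the required embedding.
\<close>

section \<open>Novikov algebras, differential commutative algebras and criteria for
  linearity\<close>

locale novikov_algebra = vector_space scale
  for scale :: "'k::field \<Rightarrow> 'n::ab_group_add \<Rightarrow> 'n" +
  fixes nov :: "'n \<Rightarrow> 'n \<Rightarrow> 'n" (infixl \<open>\<circ>\<^sub>N\<close> 70)
  assumes bilinear_nov: "bilinear_op scale (\<circ>\<^sub>N)"
    and left_symmetric: "(x \<circ>\<^sub>N y) \<circ>\<^sub>N z - x \<circ>\<^sub>N (y \<circ>\<^sub>N z) = (y \<circ>\<^sub>N x) \<circ>\<^sub>N z - y \<circ>\<^sub>N (x \<circ>\<^sub>N z)"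
    and right_commutative: "(x \<circ>\<^sub>N y) \<circ>\<^sub>N z = (x \<circ>\<^sub>N z) \<circ>\<^sub>N y"

locale differential_comm_algebra = vector_space scale
  for scale :: "'k::field \<Rightarrow> 'p::ab_group_add \<Rightarrow> 'p" +
  fixes mult :: "'p \<Rightarrow> 'p \<Rightarrow> 'p" (infixl \<open>\<cdot>\<close> 70)
    and d :: "'p \<Rightarrow> 'p"
  assumes bilinear_mult: "bilinear_op scale (\<cdot>)"
    and assoc: "(x \<cdot> y) \<cdot> z = x \<cdot> (y \<cdot> z)"
    and comm: "x \<cdot> y = y \<cdot> x"
    and linear_d: "Vector_Spaces.linear scale scale d"
    and derivation: "d (x \<cdot> y) = d x \<cdot> y + x \<cdot> d y"

lemma (in vector_space) linear_self_iff:
  "Vector_Spaces.linear scale scale f \<longleftrightarrow>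
     (\<forall>x y. f (x + y) = f x + f y) \<and> (\<forall>c x. f (scale c x) = scale c (f x))"
  by (auto simp: Vector_Spaces.linear_iff vector_space_axioms)

lemma (in vector_space) bilinear_op_iff:
  "bilinear_op scale f \<longleftrightarrow>
     (\<forall>x y z. f x (y + z) = f x y + f x z) \<and> (\<forall>c x y. f x (scale c y) = scale c (f x y)) \<and>
     (\<forall>x y z. f (x + y) z = f x z + f y z) \<and> (\<forall>c x y. f (scale c x) y = scale c (f x y))"
  unfolding bilinear_op_def linear_self_iff by auto

lemma bilinear_opD:
  assumes "bilinear_op scale f"
  shows "f x (y + z) = f x y + f x z" "f x (scale c y) = scale c (f x y)"
    "f (x + y) z = f x z + f y z" "f (scale c x) y = scale c (f x y)"
    "f 0 x = 0" "f x 0 = 0" "f x (y - z) = f x y - f x z" "f (x - y) z = f x z - f y z"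
proof -
  have l: "Vector_Spaces.linear scale scale (\<lambda>y. f x y)" "Vector_Spaces.linear scale scale (\<lambda>x. f x y)" for x y
    using assms unfolding bilinear_op_def by auto
  interpret a: Vector_Spaces.linear scale scale "\<lambda>y. f x y" by (rule l)
  interpret b: Vector_Spaces.linear scale scale "\<lambda>x. f x z" by (rule l)
  interpret c: Vector_Spaces.linear scale scale "\<lambda>z. f z y" by (rule l)
  interpret d: Vector_Spaces.linear scale scale "\<lambda>z. f z x" by (rule l)
  show "f x (y + z) = f x y + f x z" "f x (scale c y) = scale c (f x y)"
    "f (x + y) z = f x z + f y z" "f (scale c x) y = scale c (f x y)"
    "f 0 x = 0" "f x 0 = 0" "f x (y - z) = f x y - f x z" "f (x - y) z = f x z - f y z"
    by (auto simp: a.add a.scale a.diff a.zero b.add b.diff c.scale d.zero)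
qed

section \<open>Symmetric right linear maps on a Novikov algebra\<close>

context novikov_algebra
begin

lemmas nov_simps = bilinear_opD[OF bilinear_nov]

lemma nov_sum_mset: "z \<circ>\<^sub>N (\<Sum>x\<in>#M. f x) = (\<Sum>x\<in>#M. z \<circ>\<^sub>N f x)"
  by (induction M) (auto simp: nov_simps)

definition right_linear :: "('n \<Rightarrow> 'n) \<Rightarrow> bool" where
  "right_linear c \<longleftrightarrow> Vector_Spaces.linear scale scale c \<and> (\<forall>x y. c (x \<circ>\<^sub>N y) = c x \<circ>\<^sub>N y)"

text \<open>The derivative of \<open>F\<close> with its new argument \<open>z\<close> kept apart. It
  makes sense for every function on multisets, so symmetry between \<open>z\<close> and
  \<open>M\<close> can be imposed as a condition on \<open>F\<close>.\<close>

definition lie :: "'n \<Rightarrow> ('n multiset \<Rightarrow> 'n) \<Rightarrow> 'n multiset \<Rightarrow> 'n" where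
  "lie z F M = z \<circ>\<^sub>N F M - (\<Sum>x\<in>#M. F (add_mset (z \<circ>\<^sub>N x) (M - {#x#})))"

text \<open>
  Symmetric \<open>p\<close>-linear maps are functions on multisets, extended by \<open>0\<close> to multisets of other sizes.
  The last condition says that the derivative is symmetric as well.
\<close>

definition admissible :: "nat \<Rightarrow> ('n multiset \<Rightarrow> 'n) \<Rightarrow> bool" where
  "admissible p F \<longleftrightarrow> (\<forall>M. F M \<noteq> 0 \<longrightarrow> size M = p) \<and>
     (\<forall>M. Vector_Spaces.linear scale scale (\<lambda>z. F (add_mset z M))) \<and>
     (\<forall>M z c. right_linear c \<longrightarrow> F (add_mset (c z) M) = c (F (add_mset z M))) \<and>
     (\<forall>M z x. lie z F (add_mset x M) = lie x F (add_mset z M))"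

text \<open>A multiset has no first element, so \<open>SOME\<close> picks the argument acting as
  \<open>z\<close>; the last clause of \<open>admissible\<close> makes the pick irrelevant. A
  derivative has at least one argument, hence 0 at \<open>{#}\<close>.\<close>

definition jet_der :: "('n multiset \<Rightarrow> 'n) \<Rightarrow> 'n multiset \<Rightarrow> 'n" where
  "jet_der F M = (if M = {#} then 0 else let z = SOME z. z \<in># M in lie z F (M - {#z#}))"

text \<open>Here \<open>F\<close> is meant to have degree \<open>k + 1\<close>; the result does not depend on the choice of \<open>X\<close>.\<close>

definition insertion :: "nat \<Rightarrow> ('n multiset \<Rightarrow> 'n) \<Rightarrow> ('n multiset \<Rightarrow> 'n) \<Rightarrow> 'n multiset \<Rightarrow> 'n" where
  "insertion k F G M = (if k \<le> size M
     then let X = SOME X. X \<subseteq># M \<and> size X = k in F (add_mset (G (M - X)) X) else 0)"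

definition const :: "'n \<Rightarrow> 'n multiset \<Rightarrow> 'n" where
  "const x M = (if M = {#} then x else 0)"

text \<open>Models the unit: inserting it into an admissible map of positive degree changes
  nothing.\<close>

definition ident :: "'n multiset \<Rightarrow> 'n" where
  "ident M = (if size M = 1 then THE z. M = {#z#} else 0)"

text \<open>This is where right commutativity enters.\<close>

lemma right_linear_right_mult: "right_linear (\<lambda>z. z \<circ>\<^sub>N w)"
  by (simp add: right_linear_def linear_self_iff nov_simps right_commutative)

lemma right_linear_sum_mset:
  assumes "right_linear c" shows "c (\<Sum>x\<in>#M. f x) = (\<Sum>x\<in>#M. c (f x))"
proof -
  interpret Vector_Spaces.linear scale scale c using assms by (simp add: right_linear_def)
  show ?thesis by (induction M) (auto simp: add zero)
qed

lemma admissible_hom: "admissible p F \<Longrightarrow> size M \<noteq> p \<Longrightarrow> F M = 0"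
  by (auto simp: admissible_def)

lemma admissible_linear: "admissible p F \<Longrightarrow> Vector_Spaces.linear scale scale (\<lambda>z. F (add_mset z M))"
  by (simp add: admissible_def)

lemma admissible_arg:
  assumes "admissible p F"
  shows "F (add_mset (x + y) M) = F (add_mset x M) + F (add_mset y M)"
    "F (add_mset (x - y) M) = F (add_mset x M) - F (add_mset y M)"
    "F (add_mset (scale c x) M) = scale c (F (add_mset x M))"
    "F (add_mset 0 M) = 0"
    "F (add_mset (\<Sum>x\<in>#N. f x) M) = (\<Sum>x\<in>#N. F (add_mset (f x) M))"
proof -
  interpret l: Vector_Spaces.linear scale scale "\<lambda>z. F (add_mset z M)" using assms by (rule admissible_linear)
  show "F (add_mset (x + y) M) = F (add_mset x M) + F (add_mset y M)"
    "F (add_mset (x - y) M) = F (add_mset x M) - F (add_mset y M)"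
    "F (add_mset (scale c x) M) = scale c (F (add_mset x M))"
    "F (add_mset 0 M) = 0"
    by (fact l.add l.diff l.scale l.zero)+
  show "F (add_mset (\<Sum>x\<in>#N. f x) M) = (\<Sum>x\<in>#N. F (add_mset (f x) M))"
    by (induction N) (auto simp: l.add l.zero)
qed

lemma admissible_right_linear: "admissible p F \<Longrightarrow> right_linear c \<Longrightarrow> F (add_mset (c z) M) = c (F (add_mset z M))"
  by (simp add: admissible_def)

lemma admissible_lie: "admissible p F \<Longrightarrow> lie z F (add_mset x M) = lie x F (add_mset z M)"
  by (simp add: admissible_def)

text \<open>Right multiplications are right linear, so \<open>F\<close> commutes with them in each
  argument. Hence one admissible map can be pulled out of an argument of another, the key to all
  laws of \<open>insertion\<close>.\<close>

lemma right_linear_op: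
  assumes "admissible p F" shows "right_linear (\<lambda>z. F (add_mset z M))"
  using admissible_linear[OF assms] admissible_right_linear[OF assms right_linear_right_mult] by (simp add: right_linear_def)

lemma lie_add_mset:
  "lie z F (add_mset x M) = z \<circ>\<^sub>N F (add_mset x M) - F (add_mset (z \<circ>\<^sub>N x) M)
     - (\<Sum>y\<in>#M. F (add_mset x (add_mset (z \<circ>\<^sub>N y) (M - {#y#}))))"
proof -
  have "(\<Sum>y\<in>#M. F (add_mset (z \<circ>\<^sub>N y) (add_mset x M - {#y#})))
      = (\<Sum>y\<in>#M. F (add_mset x (add_mset (z \<circ>\<^sub>N y) (M - {#y#}))))"
    by (intro arg_cong[where f=sum_mset] image_mset_cong) (simp add: add_mset_commute diff_union_swap2)
  then show ?thesis by (simp add: lie_def algebra_simps)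
qed

lemma lie_zero: "(\<And>K. size K = size M \<Longrightarrow> F K = 0) \<Longrightarrow> lie z F M = 0"
proof -
  assume *: "\<And>K. size K = size M \<Longrightarrow> F K = 0"
  have "(\<Sum>x\<in>#M. F (add_mset (z \<circ>\<^sub>N x) (M - {#x#}))) = (\<Sum>x\<in>#M. 0)"
    by (intro arg_cong[where f=sum_mset] image_mset_cong *) (auto dest!: multi_member_split)
  then show ?thesis by (simp add: lie_def * nov_simps)
qed

lemma jet_der_add_mset:
  assumes "admissible p F" shows "jet_der F (add_mset z M) = lie z F M"
proof -
  define w where "w = (SOME w. w \<in># add_mset z M)"
  have w: "w \<in># add_mset z M" unfolding w_def by (rule someI[of _ z]) simp
  have "lie w F (add_mset z M - {#w#}) = lie z F M"
  proof (cases "w = z")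
    case False
    with w obtain K where "M = add_mset w K" by (auto dest: multi_member_split)
    with False show ?thesis by (simp add: admissible_lie[OF assms])
  qed simp
  then show ?thesis by (simp add: jet_der_def w_def Let_def)
qed

lemma jet_der_empty [simp]: "jet_der F {#} = 0"
  by (simp add: jet_der_def)

lemma sum_mset_minus: "(\<Sum>x\<in>#M. f x - g x) = (\<Sum>x\<in>#M. f x) - (\<Sum>x\<in>#M. g x :: 'n)"
  by (induction M) auto

lemma scale_sum_mset: "scale c (\<Sum>x\<in>#M. f x) = (\<Sum>x\<in>#M. scale c (f x))"
  by (induction M) (auto simp: scale_right_distrib)

text \<open>Both sides are the full double sum, which can be swapped, minus its diagonal.\<close>

lemma sum_mset_distinct_pairs:
  fixes f :: "'a \<Rightarrow> 'a \<Rightarrow> 'n"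
  shows "(\<Sum>y\<in>#M. \<Sum>w\<in>#M - {#y#}. f y w) = (\<Sum>y\<in>#M. \<Sum>w\<in>#M - {#y#}. f w y)"
proof -
  have *: "(\<Sum>w\<in>#M - {#y#}. g w) = (\<Sum>w\<in>#M. g w) - g y" if "y \<in># M" for g :: "'a \<Rightarrow> 'n" and y
    using that by (auto dest!: multi_member_split)
  have "(\<Sum>y\<in>#M. \<Sum>w\<in>#M - {#y#}. g y w) = (\<Sum>y\<in>#M. \<Sum>w\<in>#M. g y w) - (\<Sum>y\<in>#M. g y y)" for g :: "'a \<Rightarrow> 'a \<Rightarrow> 'n"
  proof -
    have "(\<Sum>y\<in>#M. \<Sum>w\<in>#M - {#y#}. g y w) = (\<Sum>y\<in>#M. (\<Sum>w\<in>#M. g y w) - g y y)"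
      by (intro arg_cong[where f=sum_mset] image_mset_cong) (simp add: *)
    also have "\<dots> = (\<Sum>y\<in>#M. \<Sum>w\<in>#M. g y w) - (\<Sum>y\<in>#M. g y y)"
      by (rule sum_mset_minus)
    finally show ?thesis .
  qed
  from this[of f] this[of "\<lambda>y w. f w y"] show ?thesis
    using sum_mset.swap[of f M M] by simp
qed

text \<open>\<open>lie\<close> is an action of the commutator Lie algebra of \<open>N\<close>.\<close>

lemma lie_lie:
  assumes "admissible p F"
  shows "lie z (lie x F) M - lie (z \<circ>\<^sub>N x) F M = lie x (lie z F) M - lie (x \<circ>\<^sub>N z) F M"
proof -
  let ?S = "\<lambda>z x. (\<Sum>y\<in>#M. \<Sum>w\<in>#M - {#y#}. F (add_mset (z \<circ>\<^sub>N y) (add_mset (x \<circ>\<^sub>N w) (M - {#y#} - {#w#}))))"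
  have S: "?S z x = ?S x z"
    by (subst sum_mset_distinct_pairs) (simp add: add_mset_commute diff_right_commute)
  have ll: "lie z (lie x F) M = z \<circ>\<^sub>N (x \<circ>\<^sub>N F M)
      - (\<Sum>y\<in>#M. z \<circ>\<^sub>N F (add_mset (x \<circ>\<^sub>N y) (M - {#y#})))
      - (\<Sum>y\<in>#M. x \<circ>\<^sub>N F (add_mset (z \<circ>\<^sub>N y) (M - {#y#})))
      + (\<Sum>y\<in>#M. F (add_mset (x \<circ>\<^sub>N (z \<circ>\<^sub>N y)) (M - {#y#}))) + ?S z x" for z x
  proof -
    have "lie z (lie x F) M = z \<circ>\<^sub>N lie x F M - (\<Sum>y\<in>#M. x \<circ>\<^sub>N F (add_mset (z \<circ>\<^sub>N y) (M - {#y#}))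
        - F (add_mset (x \<circ>\<^sub>N (z \<circ>\<^sub>N y)) (M - {#y#}))
        - (\<Sum>w\<in>#M - {#y#}. F (add_mset (z \<circ>\<^sub>N y) (add_mset (x \<circ>\<^sub>N w) (M - {#y#} - {#w#})))))"
      unfolding lie_def[of z] lie_add_mset by (rule refl)
    also have "\<dots> = z \<circ>\<^sub>N lie x F M - ((\<Sum>y\<in>#M. x \<circ>\<^sub>N F (add_mset (z \<circ>\<^sub>N y) (M - {#y#})))
        - (\<Sum>y\<in>#M. F (add_mset (x \<circ>\<^sub>N (z \<circ>\<^sub>N y)) (M - {#y#}))) - ?S z x)"
      unfolding sum_mset_minus by (rule refl)
    finally show ?thesis
      unfolding lie_def[of x F M] by (simp add: nov_simps nov_sum_mset)
  qed
  have l: "lie (z \<circ>\<^sub>N x) F M = (z \<circ>\<^sub>N x) \<circ>\<^sub>N F M - (\<Sum>y\<in>#M. F (add_mset ((z \<circ>\<^sub>N x) \<circ>\<^sub>N y) (M - {#y#})))" for z x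
    by (simp add: lie_def)
  \<comment> \<open>Left symmetry is used twice: here inside each argument of \<open>F\<close>, and
    at the end for the value \<open>F M\<close>.\<close>
  have "(z \<circ>\<^sub>N x) \<circ>\<^sub>N y - (x \<circ>\<^sub>N z) \<circ>\<^sub>N y = z \<circ>\<^sub>N (x \<circ>\<^sub>N y) - x \<circ>\<^sub>N (z \<circ>\<^sub>N y)" for y
    using left_symmetric[of z x y] by (simp add: algebra_simps)
  then have "F (add_mset ((z \<circ>\<^sub>N x) \<circ>\<^sub>N y) K) - F (add_mset ((x \<circ>\<^sub>N z) \<circ>\<^sub>N y) K)
      = F (add_mset (z \<circ>\<^sub>N (x \<circ>\<^sub>N y)) K) - F (add_mset (x \<circ>\<^sub>N (z \<circ>\<^sub>N y)) K)" for y K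
    by (metis admissible_arg(2)[OF assms])
  then have "(\<Sum>y\<in>#M. F (add_mset ((z \<circ>\<^sub>N x) \<circ>\<^sub>N y) (M - {#y#})) - F (add_mset ((x \<circ>\<^sub>N z) \<circ>\<^sub>N y) (M - {#y#})))
      = (\<Sum>y\<in>#M. F (add_mset (z \<circ>\<^sub>N (x \<circ>\<^sub>N y)) (M - {#y#})) - F (add_mset (x \<circ>\<^sub>N (z \<circ>\<^sub>N y)) (M - {#y#})))"
    by presburger
  with left_symmetric[of z x "F M"] S show ?thesis
    unfolding ll l sum_mset_minus by (simp add: algebra_simps)
qed

text \<open>The clause with content is symmetry of the second derivative: singling out
  \<open>x\<close> in \<open>lie z (jet_der F) (add_mset x M)\<close> gives
  \<open>lie z (lie x F) M - lie (z \<circ>\<^sub>N x) F M\<close>, the expression treated in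
  \<open>lie_lie\<close>.\<close>

lemma admissible_jet_der:
  assumes F: "admissible p F" shows "admissible (Suc p) (jet_der F)"
proof -
  note d = jet_der_add_mset[OF F]
  have hom: "size M = Suc p" if "jet_der F M \<noteq> 0" for M
  proof (cases M)
    case empty
    with that show ?thesis by simp
  next
    case (add z K)
    have "lie z F K = 0" if "size K \<noteq> p"
      using that by (intro lie_zero admissible_hom[OF F]) simp
    with add that show ?thesis by (auto simp: d)
  qed
  have lin: "Vector_Spaces.linear scale scale (\<lambda>z. jet_der F (add_mset z M))" for M
    by (simp add: d linear_self_iff lie_def nov_simps admissible_arg[OF F] sum_mset.distrib scale_sum_mset
      scale_right_diff_distrib algebra_simps)
  have cl: "jet_der F (add_mset (c z) M) = c (jet_der F (add_mset z M))" if c: "right_linear c" for c z M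
  proof -
    interpret Vector_Spaces.linear scale scale c using c by (simp add: right_linear_def)
    from c show ?thesis
      unfolding d lie_def diff right_linear_sum_mset[OF c]
      by (simp add: right_linear_def admissible_right_linear[OF F c, symmetric])
  qed
  have ds: "lie z (jet_der F) (add_mset x M) = lie x (jet_der F) (add_mset z M)" for z x M
  proof -
    have "lie z (jet_der F) (add_mset x M) = lie z (lie x F) M - lie (z \<circ>\<^sub>N x) F M" for z x
      unfolding lie_add_mset[of z "jet_der F"] d lie_def[of z "lie x F"] by simp
    with lie_lie[OF F] show ?thesis by simp
  qed
  from hom lin cl ds show ?thesis unfolding admissible_def by blast
qed

section \<open>Insertion as a commutative, associative product with a Leibniz rule\<close>

text \<open>Let \<open>X\<close> consist of \<open>x\<close> and \<open>A\<close>, and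
  \<open>Y\<close> of \<open>x'\<close> and \<open>B\<close>. Pulling \<open>G\<close> out of the
  argument of \<open>F\<close> gives \<open>G (add_mset (F (add_mset x' (add_mset x A))) B)\<close>,
  which is symmetric in \<open>x\<close> and \<open>x'\<close>. So \<open>X\<close> turns into
  \<open>X'\<close> one exchange at a time.\<close>

lemma insertion_exchange:
  assumes F: "admissible p F" and G: "admissible q G" and "X + Y = X' + Y'" "size X = size X'"
  shows "F (add_mset (G Y) X) = F (add_mset (G Y') X')"
  using assms(3,4)
proof (induction "size (X - X')" arbitrary: X Y)
  case 0
  then have "X \<subseteq># X'" by (simp add: Diff_eq_empty_iff_mset)
  with 0 have "X = X'" by (metis mset_subset_size order_less_irrefl subset_mset.le_imp_less_or_eq)
  with 0 show ?case by simp
next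
  case (Suc n)
  then obtain x where x: "x \<in># X - X'" by (metis size_eq_Suc_imp_elem)
  have "X' - X \<noteq> {#}"
  proof
    assume "X' - X = {#}"
    then have "X' \<subseteq># X" by (simp add: Diff_eq_empty_iff_mset)
    with Suc have "X = X'" by (metis mset_subset_size order_less_irrefl subset_mset.le_imp_less_or_eq)
    with x show False by simp
  qed
  then obtain x' where x': "x' \<in># X' - X" by blast
  define A where "A = X - {#x#}"
  have X: "X = add_mset x A" using x by (simp add: A_def in_diffD)
  have xx': "x \<noteq> x'" using x x' by (auto simp: in_diff_count)
  have "x' \<in># Y"
  proof -
    have "count X x' < count X' x'" using x' by (simp add: in_diff_count)
    moreover have "count X x' + count Y x' = count X' x' + count Y' x'"
      using Suc.prems(1) by (metis count_union)
    ultimately show ?thesis by (simp add: count_greater_zero_iff[symmetric] del: count_greater_zero_iff)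
  qed
  then obtain B where Y: "Y = add_mset x' B" by (meson multi_member_split)
  let ?X = "add_mset x' A" and ?Y = "add_mset x B"
  have "X - X' = add_mset x (?X - X')"
  proof (rule multiset_eqI)
    fix a
    have "count X' x < count X x" "count X x' < count X' x'" using x x' by (simp_all add: in_diff_count)
    then show "count (X - X') a = count (add_mset x (?X - X')) a"
      using xx' by (auto simp: X)
  qed
  with Suc.hyps(2) have n: "n = size (?X - X')" by simp
  have "F (add_mset (G Y) X) = G (add_mset (F (add_mset x' (add_mset x A))) B)"
    by (simp add: X Y admissible_right_linear[OF F right_linear_op[OF G]])
  also have "\<dots> = F (add_mset (G ?Y) ?X)"
    using admissible_right_linear[OF F right_linear_op[OF G, of B], of x "add_mset x' A"] by (simp add: add_mset_commute)
  also have "\<dots> = F (add_mset (G Y') X')"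
    using Suc.prems by (intro Suc.hyps(1)[OF n]) (auto simp: X Y add_mset_commute)
  finally show ?case .
qed

lemma insertion_small: "size M < k \<Longrightarrow> insertion k F G M = 0"
  by (simp add: insertion_def)

lemma insertion_add:
  assumes F: "admissible p F" and G: "admissible q G" and X: "size X = k"
  shows "insertion k F G (X + Y) = F (add_mset (G Y) X)"
proof -
  define Z where "Z = (SOME Z. Z \<subseteq># X + Y \<and> size Z = k)"
  have "Z \<subseteq># X + Y \<and> size Z = k" unfolding Z_def by (rule someI[of _ X]) (simp add: X)
  then have "F (add_mset (G (X + Y - Z)) Z) = F (add_mset (G Y) X)"
    using X by (intro insertion_exchange[OF F G]) auto
  with X show ?thesis by (simp add: insertion_def Z_def Let_def)
qed

lemma mset_split:
  fixes M :: "'a multiset"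
  assumes "k \<le> size M"
  obtains X Y where "M = X + Y" "size X = k"
proof -
  obtain xs where xs: "M = mset xs" using ex_mset by metis
  have "M = mset (take k xs) + mset (drop k xs)" by (simp add: xs flip: mset_append)
  moreover have "size (mset (take k xs)) = k" using assms by (simp add: xs)
  ultimately show thesis by (rule that)
qed

lemma insertion_hom:
  assumes F: "admissible (Suc k) F" and G: "admissible q G" and M: "size M \<noteq> k + q"
  shows "insertion k F G M = 0"
proof (cases "k \<le> size M")
  case True
  then obtain X Y where XY: "M = X + Y" "size X = k" by (rule mset_split)
  with M have "G Y = 0" by (intro admissible_hom[OF G]) auto
  with XY show ?thesis by (simp add: insertion_add[OF F G] admissible_arg(4)[OF F])
qed (simp add: insertion_small)

text \<open>The Leibniz rule. \<open>lie z F\<close> at the arguments \<open>G Y\<close> and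
  \<open>X\<close> contains a term with \<open>z \<circ>\<^sub>N G Y\<close> in place of
  \<open>G Y\<close>; it cancels against the leading term of \<open>lie z G Y\<close> inside
  \<open>F\<close>.\<close>

lemma lie_insertion:
  assumes F: "admissible (Suc k) F" and G: "admissible q G" and M: "k \<le> size M"
  shows "lie z (insertion k F G) M = insertion (Suc k) (jet_der F) G (add_mset z M) + insertion k F (jet_der G) (add_mset z M)"
proof -
  note dF = admissible_jet_der[OF F] and dG = admissible_jet_der[OF G]
  obtain X Y where XY: "M = X + Y" and k: "size X = k" using M by (rule mset_split)
  note st = insertion_add[OF F G k]
  have 1: "(\<Sum>x\<in>#X. insertion k F G (add_mset (z \<circ>\<^sub>N x) (X + Y - {#x#})))
      = (\<Sum>x\<in>#X. F (add_mset (G Y) (add_mset (z \<circ>\<^sub>N x) (X - {#x#}))))"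
  proof (intro arg_cong[where f=sum_mset] image_mset_cong)
    fix x assume x: "x \<in># X"
    then have "add_mset (z \<circ>\<^sub>N x) (X + Y - {#x#}) = add_mset (z \<circ>\<^sub>N x) (X - {#x#}) + Y"
      by (auto dest!: multi_member_split)
    moreover have "size (add_mset (z \<circ>\<^sub>N x) (X - {#x#})) = k"
      using x k by (auto dest!: multi_member_split)
    ultimately show "insertion k F G (add_mset (z \<circ>\<^sub>N x) (X + Y - {#x#}))
        = F (add_mset (G Y) (add_mset (z \<circ>\<^sub>N x) (X - {#x#})))"
      by (simp only: insertion_add[OF F G])
  qed
  have 2: "(\<Sum>y\<in>#Y. insertion k F G (add_mset (z \<circ>\<^sub>N y) (X + Y - {#y#})))
      = F (add_mset (\<Sum>y\<in>#Y. G (add_mset (z \<circ>\<^sub>N y) (Y - {#y#}))) X)"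
    unfolding admissible_arg(5)[OF F]
  proof (intro arg_cong[where f=sum_mset] image_mset_cong)
    fix y assume y: "y \<in># Y"
    then have "add_mset (z \<circ>\<^sub>N y) (X + Y - {#y#}) = X + add_mset (z \<circ>\<^sub>N y) (Y - {#y#})"
      by (auto dest!: multi_member_split)
    then show "insertion k F G (add_mset (z \<circ>\<^sub>N y) (X + Y - {#y#}))
        = F (add_mset (G (add_mset (z \<circ>\<^sub>N y) (Y - {#y#}))) X)"
      by (simp only: st)
  qed
  have "lie z (insertion k F G) M = z \<circ>\<^sub>N F (add_mset (G Y) X)
      - (\<Sum>x\<in>#X. F (add_mset (G Y) (add_mset (z \<circ>\<^sub>N x) (X - {#x#}))))
      - F (add_mset (\<Sum>y\<in>#Y. G (add_mset (z \<circ>\<^sub>N y) (Y - {#y#}))) X)"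
    by (simp add: lie_def XY st 1 2)
  also have "\<dots> = lie z F (add_mset (G Y) X) + F (add_mset (lie z G Y) X)"
    unfolding lie_add_mset by (simp add: lie_def[of z G] admissible_arg[OF F])
  \<comment> \<open>The two summands come from two splittings of \<open>add_mset z M\<close>: here
    \<open>z\<close> joins \<open>X\<close>, in the next one it joins \<open>Y\<close>.\<close>
  also have "lie z F (add_mset (G Y) X) = insertion (Suc k) (jet_der F) G (add_mset z X + Y)"
    using k by (subst insertion_add[OF dF G]) (auto simp: jet_der_add_mset[OF F] admissible_lie[OF F, of z])
  also have "F (add_mset (lie z G Y) X) = insertion k F (jet_der G) (X + add_mset z Y)"
    by (simp only: insertion_add[OF F dG k] jet_der_add_mset[OF G])
  finally show ?thesis by (simp add: XY)
qed

lemma admissible_insertion: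
  assumes F: "admissible (Suc k) F" and G: "admissible q G" shows "admissible (k + q) (insertion k F G)"
proof -
  have lc: "Vector_Spaces.linear scale scale (\<lambda>z. insertion k F G (add_mset z M)) \<and>
    (right_linear c \<longrightarrow> (\<forall>z. insertion k F G (add_mset (c z) M) = c (insertion k F G (add_mset z M))))" for M c
  proof -
    \<comment> \<open>In the second case all arguments, \<open>z\<close> included, go into
      \<open>F\<close>, and \<open>G\<close> is evaluated at \<open>{#}\<close>; in the third there
      are too few arguments.\<close>
    consider "k \<le> size M" | "k = Suc (size M)" | "Suc (size M) < k" by linarith
    then show ?thesis
    proof cases
      case 1
      then obtain X Y where "M = X + Y" "size X = k" by (rule mset_split)
      then have *: "insertion k F G (add_mset z M) = F (add_mset (G (add_mset z Y)) X)" for z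
        using insertion_add[OF F G, of X k "add_mset z Y"] by simp
      show ?thesis
        by (simp add: * linear_self_iff admissible_arg[OF F] admissible_arg[OF G] admissible_right_linear[OF F] admissible_right_linear[OF G])
    next
      case 2
      then have *: "insertion k F G (add_mset z M) = F (add_mset z (add_mset (G {#}) M))" for z
        using insertion_add[OF F G, of "add_mset z M" k "{#}"] by (simp add: add_mset_commute)
      show ?thesis
        by (simp add: * linear_self_iff admissible_arg[OF F] admissible_right_linear[OF F])
    next
      case 3
      then have *: "insertion k F G (add_mset z M) = 0" for z by (simp add: insertion_small)
      have "c 0 = 0" if "right_linear c"
        using right_linear_sum_mset[OF that, of id "{#}"] by simp
      then show ?thesis by (simp add: * linear_self_iff)
    qed
  qed
  \<comment> \<open>By \<open>lie_insertion\<close> the value depends only on the multiset of all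
    arguments, \<open>z\<close> and \<open>x\<close> included.\<close>
  have "lie z (insertion k F G) (add_mset x M) = lie x (insertion k F G) (add_mset z M)" for z x M
  proof (cases "k \<le> Suc (size M)")
    case True
    then show ?thesis
      using lie_insertion[OF F G, of "add_mset x M" z] lie_insertion[OF F G, of "add_mset z M" x]
      by (simp add: add_mset_commute)
  next
    case False
    then have "lie z (insertion k F G) (add_mset x M) = 0" for z x
      by (intro lie_zero insertion_small) simp
    then show ?thesis by simp
  qed
  with lc insertion_hom[OF F G] show ?thesis unfolding admissible_def by blast
qed

text \<open>Beyond \<open>lie_insertion\<close> there remain the multisets with at most
  \<open>k\<close> elements, where everything vanishes; at exactly \<open>k\<close> elements the
  last summand does so because \<open>jet_der G\<close> is evaluated at \<open>{#}\<close>.\<close>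

lemma jet_der_insertion:
  assumes F: "admissible (Suc k) F" and G: "admissible q G"
  shows "jet_der (insertion k F G) M = insertion (Suc k) (jet_der F) G M + insertion k F (jet_der G) M"
proof (cases M)
  case empty
  have "insertion k F (jet_der G) {#} = 0"
  proof (cases "k = 0")
    case True
    then show ?thesis
      using insertion_add[OF F admissible_jet_der[OF G], of "{#}" k "{#}"] by (simp add: admissible_arg(4)[OF F])
  qed (simp add: insertion_small)
  with empty show ?thesis by (simp add: insertion_small)
next
  case (add z K)
  note d = jet_der_add_mset[OF admissible_insertion[OF F G]]
  show ?thesis
  proof (cases "k \<le> size K")
    case True
    then show ?thesis by (simp add: add d lie_insertion[OF F G])
  next
    case False
    then have "lie z (insertion k F G) K = 0" by (intro lie_zero insertion_small) simp
    moreover have "insertion k F (jet_der G) (add_mset z K) = 0"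
    proof (cases "k = Suc (size K)")
      case True
      then show ?thesis
        using insertion_add[OF F admissible_jet_der[OF G], of "add_mset z K" k "{#}"] by (simp add: admissible_arg(4)[OF F])
    next
      case F: False
      with False show ?thesis by (intro insertion_small) simp
    qed
    ultimately show ?thesis using False by (simp add: add d insertion_small)
  qed
qed

lemma insertion_assoc:
  assumes F: "admissible (Suc k) F" and G: "admissible (Suc l) G" and H: "admissible r H"
  shows "insertion (k + l) (insertion k F G) H = insertion k F (insertion l G H)"
proof
  fix M
  have FG: "admissible (k + Suc l) (insertion k F G)" and GH: "admissible (l + r) (insertion l G H)"
    using F G H admissible_insertion by blast+
  show "insertion (k + l) (insertion k F G) H M = insertion k F (insertion l G H) M"
  proof (cases "k + l \<le> size M")
    case True
    then obtain W Z where W: "M = W + Z" "size W = k + l" by (rule mset_split)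
    then obtain X Y where X: "W = X + Y" "size X = k" by (metis le_add1 mset_split)
    with W have Y: "size Y = l" by simp
    have "insertion (k + l) (insertion k F G) H M = insertion k F G (X + add_mset (H Z) Y)"
      using W X insertion_add[OF FG H, of W "k + l" Z] by simp
    also have "\<dots> = F (add_mset (insertion l G H (Y + Z)) X)"
      using X Y by (simp only: insertion_add[OF F G] insertion_add[OF G H])
    also have "\<dots> = insertion k F (insertion l G H) (X + (Y + Z))"
      using X by (simp only: insertion_add[OF F GH])
    finally show ?thesis by (simp add: W X add.assoc)
  next
    case small: False
    show ?thesis
    proof (cases "k \<le> size M")
      case True
      then obtain X Y where X: "M = X + Y" "size X = k" by (rule mset_split)
      with small show ?thesis
        by (simp add: insertion_add[OF F GH] insertion_small admissible_arg(4)[OF F])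
    qed (use small in \<open>simp add: insertion_small\<close>)
  qed
qed

text \<open>Both degrees being positive, some argument \<open>z\<close> passes through
  \<open>G\<close> into \<open>F\<close>; pulling \<open>G\<close> out by right linearity exchanges
  the two maps.\<close>

lemma insertion_commute:
  assumes F: "admissible (Suc k) F" and G: "admissible (Suc l) G"
  shows "insertion k F G = insertion l G F"
proof
  fix M
  show "insertion k F G M = insertion l G F M"
  proof (cases "size M = k + Suc l")
    case True
    then have "k \<le> size M" by simp
    then obtain X Y' where X: "M = X + Y'" "size X = k" by (rule mset_split)
    with True obtain z Y where Y: "Y' = add_mset z Y" "size Y = l"
      by (metis add_left_cancel size_Suc_Diff1 size_eq_Suc_imp_eq_union size_add_mset size_union nat.inject)
    have "insertion k F G M = F (add_mset (G (add_mset z Y)) X)"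
      using X Y by (simp only: insertion_add[OF F G])
    also have "\<dots> = insertion l G F (Y + add_mset z X)"
      using Y by (simp only: insertion_add[OF G F] admissible_right_linear[OF F right_linear_op[OF G]])
    finally show ?thesis using X Y by (simp add: add.commute)
  next
    case False
    then show ?thesis using insertion_hom[OF F G] insertion_hom[OF G F] by simp
  qed
qed

lemma insertion_left_commute:
  assumes F: "admissible (Suc k) F" and G: "admissible (Suc l) G" and H: "admissible r H"
  shows "insertion k F (insertion l G H) = insertion l G (insertion k F H)"
  using insertion_assoc[OF F G H] insertion_assoc[OF G F H] insertion_commute[OF F G] by (simp add: add.commute)

section \<open>Maps of degree 0, the identity and linear combinations\<close>

lemma right_linear_zero: "right_linear c \<Longrightarrow> c 0 = 0"
  using right_linear_sum_mset[of c id "{#}"] by simp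

lemma admissible_const: "admissible 0 (const x)"
proof -
  have "lie z (const x) (add_mset y M) = 0" for z y M
    by (intro lie_zero) (auto simp: const_def)
  then show ?thesis
    by (auto simp: admissible_def const_def linear_self_iff right_linear_zero)
qed

lemma admissible_zero_eq_const: "admissible 0 F \<Longrightarrow> F = const (F {#})"
  by (auto simp: const_def fun_eq_iff admissible_hom)

lemma insertion_const:
  assumes F: "admissible (Suc k) F"
  shows "insertion k F (const x) M = F (add_mset x M)"
proof (cases "size M = k")
  case True
  then show ?thesis using insertion_add[OF F admissible_const, of M k x "{#}"] by (simp add: const_def)
next
  case False
  then show ?thesis using insertion_hom[OF F admissible_const] by (simp add: admissible_hom[OF F])
qed

text \<open>The derivative of \<open>y\<close> is right multiplication by \<open>y\<close>; this is
  why \<open>x d(y)\<close> will be the Novikov product.\<close>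

lemma jet_der_const: "jet_der (const y) {#z#} = z \<circ>\<^sub>N y"
  by (simp add: jet_der_add_mset[OF admissible_const] lie_def const_def)

lemma ident_simps: "ident {#z#} = z" "size M \<noteq> 1 \<Longrightarrow> ident M = 0"
  by (auto simp: ident_def)

lemma admissible_ident: "admissible 1 ident"
proof -
  have i: "ident (add_mset z M) = (if M = {#} then z else 0)" for z M
    by (simp add: ident_simps)
  have "lie z ident (add_mset x M) = lie x ident (add_mset z M)" for z x M
    unfolding lie_add_mset i by (simp add: nov_simps)
  moreover have "size M = 1" if "ident M \<noteq> 0" for M
    using that by (auto simp: ident_def split: if_splits)
  ultimately show ?thesis
    by (simp add: admissible_def i linear_self_iff right_linear_zero)
qed

lemma admissible_lincomb:
  assumes F: "admissible p F" and G: "admissible p G"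
  shows "admissible p (\<lambda>M. scale c (F M) + G M)"
    and "jet_der (\<lambda>M. scale c (F M) + G M) = (\<lambda>M. scale c (jet_der F M) + jet_der G M)"
proof -
  let ?H = "\<lambda>M. scale c (F M) + G M"
  have l: "lie z ?H M = scale c (lie z F M) + lie z G M" for z M
    by (simp add: lie_def nov_simps sum_mset.distrib scale_right_diff_distrib scale_sum_mset algebra_simps)
  have "?H (add_mset (e z) M) = e (?H (add_mset z M))" if "right_linear e" for e z M
  proof -
    interpret Vector_Spaces.linear scale scale e using that by (simp add: right_linear_def)
    show ?thesis using that by (simp add: add scale admissible_right_linear[OF F] admissible_right_linear[OF G])
  qed
  moreover have "size M = p" if "?H M \<noteq> 0" for M
    using that admissible_hom[OF F, of M] admissible_hom[OF G, of M] by (cases "size M = p") auto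
  moreover have "lie z ?H (add_mset x M) = lie x ?H (add_mset z M)" for z x M
    by (simp add: l admissible_lie[OF F, of z] admissible_lie[OF G, of z])
  moreover have "Vector_Spaces.linear scale scale (\<lambda>z. ?H (add_mset z M))" for M
    by (simp add: linear_self_iff admissible_arg[OF F] admissible_arg[OF G] scale_right_distrib algebra_simps)
  ultimately show H: "admissible p ?H"
    unfolding admissible_def by blast
  show "jet_der ?H = (\<lambda>M. scale c (jet_der F M) + jet_der G M)"
  proof
    fix M show "jet_der ?H M = scale c (jet_der F M) + jet_der G M"
      by (cases M) (simp_all add: jet_der_add_mset[OF F] jet_der_add_mset[OF G] jet_der_add_mset[OF H] l)
  qed
qed

end

section \<open>Linear extension and derivations of polynomial rings\<close>

definition pscale :: "'k::field \<Rightarrow> ('x \<Rightarrow>\<^sub>0 'k) \<Rightarrow> ('x \<Rightarrow>\<^sub>0 'k)" where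
  "pscale c u = Poly_Mapping.map ((*) c) u"

lemma lookup_pscale [simp]: "Poly_Mapping.lookup (pscale c u) x = c * Poly_Mapping.lookup u x"
  by (simp add: pscale_def map.rep_eq when_def)

interpretation pm: vector_space pscale
  by unfold_locales (auto intro!: poly_mapping_eqI simp: lookup_add algebra_simps)

lemma pscale_single [simp]: "pscale c (Poly_Mapping.single x a) = Poly_Mapping.single x (c * a)"
  by (auto intro!: poly_mapping_eqI simp: lookup_single when_def)

lemma pscale_conv_mult: "pscale c u = Poly_Mapping.single 0 c * (u :: 'x::monoid_add \<Rightarrow>\<^sub>0 'k::field)"
  by (simp add: pscale_def mult_map_scale_conv_mult)

lemma pscale_mult:
  fixes u v :: "'x::comm_monoid_add \<Rightarrow>\<^sub>0 'k::field"
  shows "pscale c u * v = pscale c (u * v)" "u * pscale c v = pscale c (u * v)"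
  by (simp_all add: pscale_conv_mult algebra_simps)

definition pm_extend :: "('k::field \<Rightarrow> 'v::ab_group_add \<Rightarrow> 'v) \<Rightarrow> ('x \<Rightarrow> 'v) \<Rightarrow> ('x \<Rightarrow>\<^sub>0 'k) \<Rightarrow> 'v" where
  "pm_extend scale g u = (\<Sum>x\<in>Poly_Mapping.keys u. scale (Poly_Mapping.lookup u x) (g x))"

context vector_space
begin

lemma pm_extend_superset:
  assumes "finite A" "Poly_Mapping.keys u \<subseteq> A"
  shows "pm_extend scale g u = (\<Sum>x\<in>A. scale (Poly_Mapping.lookup u x) (g x))"
  unfolding pm_extend_def using assms by (intro sum.mono_neutral_left) (auto simp: in_keys_iff)

lemma linear_pm_extend: "Vector_Spaces.linear pscale scale (pm_extend scale g)"
proof -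
  have "pm_extend scale g (u + v) = pm_extend scale g u + pm_extend scale g v" for u v
  proof -
    let ?A = "Poly_Mapping.keys u \<union> Poly_Mapping.keys v"
    have "Poly_Mapping.keys (u + v) \<subseteq> ?A" by (rule Poly_Mapping.keys_add)
    then show ?thesis
      using pm_extend_superset[of ?A u] pm_extend_superset[of ?A v] pm_extend_superset[of ?A "u + v"]
      by (simp add: lookup_add scale_left_distrib sum.distrib)
  qed
  moreover have "pm_extend scale g (pscale c u) = scale c (pm_extend scale g u)" for c u
  proof -
    have "Poly_Mapping.keys (pscale c u) \<subseteq> Poly_Mapping.keys u" by (auto simp: in_keys_iff)
    then show ?thesis
      using pm_extend_superset[of "Poly_Mapping.keys u" "pscale c u"] pm_extend_superset[of "Poly_Mapping.keys u" u]
      by (simp add: scale_sum_right)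
  qed
  ultimately show ?thesis
    by (simp add: Vector_Spaces.linear_iff vector_space_axioms pm.vector_space_axioms)
qed

lemma pm_extend_single [simp]: "pm_extend scale g (Poly_Mapping.single x c) = scale c (g x)"
  by (subst pm_extend_superset[of "{x}"]) (auto simp: lookup_single)

end

lemma pm_extend_id: "pm_extend pscale (\<lambda>x. Poly_Mapping.single x 1) u = u"
  by (auto intro!: poly_mapping_eqI simp: pm_extend_def lookup_sum lookup_single when_def in_keys_iff)

lemma pm_subspace_UNIV:
  assumes "pm.subspace S" "\<And>x. Poly_Mapping.single x 1 \<in> S"
  shows "u \<in> S"
proof -
  have "pm_extend pscale (\<lambda>x. Poly_Mapping.single x 1) u \<in> S"
    unfolding pm_extend_def using assms by (intro pm.subspace_sum pm.subspace_scale)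
  then show ?thesis by (simp add: pm_extend_id)
qed

lemma pm_linear_eq:
  assumes "Vector_Spaces.linear pscale scale f" "Vector_Spaces.linear pscale scale g"
    and "\<And>x. f (Poly_Mapping.single x 1) = g (Poly_Mapping.single x 1)"
  shows "f u = g u"
proof -
  interpret f: Vector_Spaces.linear pscale scale f by fact
  interpret g: Vector_Spaces.linear pscale scale g by fact
  have "u \<in> {u. f u = g u}"
    by (rule pm_subspace_UNIV) (auto simp: assms(3) pm.subspace_def f.add g.add f.scale g.scale f.zero g.zero)
  then show ?thesis by simp
qed

text \<open>With multisets of letters as monomials,
  \<open>'l multiset \<Rightarrow>\<^sub>0 'k\<close> is the commutative polynomial ring; this is
  its derivation taking each letter \<open>l\<close> to \<open>f l\<close>.\<close>

definition mpoly_der :: "('l \<Rightarrow> 'l) \<Rightarrow> ('l multiset \<Rightarrow>\<^sub>0 'k::field) \<Rightarrow> ('l multiset \<Rightarrow>\<^sub>0 'k)" where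
  "mpoly_der f = pm_extend pscale (\<lambda>m. \<Sum>l\<in>#m. Poly_Mapping.single (add_mset (f l) (m - {#l#})) 1)"

lemma linear_mpoly_der: "Vector_Spaces.linear pscale pscale (mpoly_der f)"
  unfolding mpoly_der_def by (rule pm.linear_pm_extend)

lemma mpoly_der_monom:
  "mpoly_der f (Poly_Mapping.single m 1) = (\<Sum>l\<in>#m. Poly_Mapping.single (add_mset (f l) (m - {#l#})) 1)"
  by (simp add: mpoly_der_def)

text \<open>On monomials each letter of the product comes from one of the two factors; linearity
  extends this first in \<open>v\<close>, then in \<open>u\<close>.\<close>

lemma mpoly_der_mult:
  fixes u v :: "'l multiset \<Rightarrow>\<^sub>0 'k::field"
  shows "mpoly_der f (u * v) = mpoly_der f u * v + u * mpoly_der f v"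
proof -
  interpret D: Vector_Spaces.linear pscale pscale "mpoly_der f" by (rule linear_mpoly_der)
  have mono: "mpoly_der f (Poly_Mapping.single m (1::'k) * Poly_Mapping.single n 1)
      = mpoly_der f (Poly_Mapping.single m 1) * Poly_Mapping.single n 1
        + Poly_Mapping.single m 1 * mpoly_der f (Poly_Mapping.single n 1)" for m n
  proof -
    have s: "(\<Sum>l\<in>#m. Poly_Mapping.single (add_mset (f l) (m + n - {#l#})) (1::'k))
       = (\<Sum>l\<in>#m. Poly_Mapping.single (add_mset (f l) (m - {#l#})) 1 * Poly_Mapping.single n 1)" for m n
      by (intro arg_cong[where f=sum_mset] image_mset_cong)
        (auto dest!: multi_member_split simp: mult_single)
    have "mpoly_der f (Poly_Mapping.single m 1 * Poly_Mapping.single n 1)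
      = (\<Sum>l\<in>#m + n. Poly_Mapping.single (add_mset (f l) (m + n - {#l#})) (1::'k))"
      by (simp add: mult_single mpoly_der_monom)
    also have "\<dots> = mpoly_der f (Poly_Mapping.single m 1) * Poly_Mapping.single n 1
        + Poly_Mapping.single m 1 * mpoly_der f (Poly_Mapping.single n 1)"
      using s[of m n] s[of n m]
      by (simp add: mpoly_der_monom sum_mset_distrib_left sum_mset_distrib_right add.commute[of n m] mult.commute)
    finally show ?thesis .
  qed
  have lin: "Vector_Spaces.linear pscale pscale (\<lambda>v. mpoly_der f (u * v))"
    "Vector_Spaces.linear pscale pscale (\<lambda>v. mpoly_der f u * v + u * mpoly_der f v)"
    "Vector_Spaces.linear pscale pscale (\<lambda>v. mpoly_der f (v * u))"
    "Vector_Spaces.linear pscale pscale (\<lambda>v. mpoly_der f v * u + v * mpoly_der f u)" for u :: "'l multiset \<Rightarrow>\<^sub>0 'k"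
    by (simp_all add: pm.linear_self_iff D.add D.scale pscale_mult algebra_simps)
  have "mpoly_der f (Poly_Mapping.single m 1 * v)
      = mpoly_der f (Poly_Mapping.single m 1) * v + Poly_Mapping.single m 1 * mpoly_der f v"
    for m and v :: "'l multiset \<Rightarrow>\<^sub>0 'k"
    by (rule pm_linear_eq[OF lin(1,2) mono])
  then show ?thesis
    by (rule pm_linear_eq[OF lin(3,4)])
qed

text \<open>Realises the quotient by \<open>W\<close> inside the space itself: \<open>\<pi>\<close>
  picks one representative of each coset, linearly.\<close>

lemma (in vector_space) exists_projection:
  assumes "subspace W"
  shows "\<exists>\<pi>. Vector_Spaces.linear scale scale \<pi> \<and> (\<forall>x. \<pi> x = 0 \<longleftrightarrow> x \<in> W) \<and> (\<forall>x. x - \<pi> x \<in> W)"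
proof -
  have "\<exists>g. g ` UNIV \<subseteq> W \<and> Vector_Spaces.linear scale scale g \<and> (\<forall>v\<in>W. g v = v)"
    using vector_space_pair.linear_exists_left_inverse_on[OF vector_space_pair.intro linear_ident assms] vector_space_axioms
    by simp
  then obtain g where g: "range g \<subseteq> W" "Vector_Spaces.linear scale scale g" "\<And>v. v \<in> W \<Longrightarrow> g v = v"
    by blast
  have "Vector_Spaces.linear scale scale (\<lambda>x. x - g x)"
    using g(2) by (simp add: linear_self_iff algebra_simps)
  moreover have "x - g x = 0 \<longleftrightarrow> x \<in> W" for x using g(1) g(3)[of x] by auto
  moreover have "x - (x - g x) \<in> W" for x using g(1) by auto
  ultimately show ?thesis by blast
qed

section \<open>Embedding a Novikov algebra\<close>

context novikov_algebra
begin

text \<open>A letter carries its degree because the map does not determine it: the zero map is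
  admissible in every degree.\<close>

definition letter :: "nat \<times> ('n multiset \<Rightarrow> 'n) \<Rightarrow> (nat \<times> ('n multiset \<Rightarrow> 'n)) multiset \<Rightarrow>\<^sub>0 'k" where
  "letter l = Poly_Mapping.single {#l#} 1"

definition letter_der :: "nat \<times> ('n multiset \<Rightarrow> 'n) \<Rightarrow> nat \<times> ('n multiset \<Rightarrow> 'n)" where
  "letter_der l = (Suc (fst l), jet_der (snd l))"

text \<open>\<open>lin\<close> makes \<open>letter\<close> linear in the map, one degree at a time.
  \<open>prod\<close> needs an argument of \<open>F\<close> to insert \<open>G\<close> into, so the
  first factor has positive degree and the second any degree.\<close>

inductive_set relators :: "((nat \<times> ('n multiset \<Rightarrow> 'n)) multiset \<Rightarrow>\<^sub>0 'k) set" where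
  lin: "admissible p F \<Longrightarrow> admissible p G \<Longrightarrow>
    letter (p, \<lambda>M. scale c (F M) + G M) - pscale c (letter (p, F)) - letter (p, G) \<in> relators"
| prod: "admissible (Suc k) F \<Longrightarrow> admissible q G \<Longrightarrow>
    letter (Suc k, F) * letter (q, G) - letter (k + q, insertion k F G) \<in> relators"

definition relator_ideal :: "((nat \<times> ('n multiset \<Rightarrow> 'n)) multiset \<Rightarrow>\<^sub>0 'k) set" where
  "relator_ideal = pm.span {u * r | u r. r \<in> relators}"

lemma relator_in_ideal: "r \<in> relators \<Longrightarrow> u * r \<in> relator_ideal" "r \<in> relators \<Longrightarrow> r \<in> relator_ideal"
  unfolding relator_ideal_def by (auto intro!: pm.span_base) (metis mult_1)

lemma subspace_relator_ideal: "pm.subspace relator_ideal"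
  unfolding relator_ideal_def by (rule pm.subspace_span)

lemma relator_ideal_mult: "v \<in> relator_ideal \<Longrightarrow> u * v \<in> relator_ideal"
  unfolding relator_ideal_def
proof (induction rule: pm.span_induct_alt)
  case (step c x y)
  then obtain w r where "x = w * r" "r \<in> relators" by blast
  with step have "(u * w) * r \<in> pm.span {u * r |u r. r \<in> relators}"
    by (intro pm.span_base) blast
  with step \<open>x = w * r\<close> show ?case
    by (simp add: distrib_left pscale_mult pm.span_add pm.span_scale mult.assoc)
qed (simp add: pm.span_zero)

lemma mpoly_der_letter: "mpoly_der letter_der (letter (p, F)) = letter (Suc p, jet_der F)"
  by (simp add: letter_def mpoly_der_monom letter_der_def)

text \<open>A \<open>lin\<close> relator goes to a \<open>lin\<close> relator. By the Leibniz rule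
  for insertion, a \<open>prod\<close> relator goes to a sum of two \<open>prod\<close> relators
  minus a \<open>lin\<close> relator.\<close>

lemma mpoly_der_relators:
  assumes "r \<in> relators" shows "mpoly_der letter_der r \<in> relator_ideal"
proof -
  interpret D: Vector_Spaces.linear pscale pscale "mpoly_der letter_der" by (rule linear_mpoly_der)
  show ?thesis
    using assms
  proof cases
    case (lin p F G c)
    then show ?thesis
      using relators.lin[OF admissible_jet_der admissible_jet_der, OF lin(2,3)]
      by (auto simp: D.diff D.scale mpoly_der_letter admissible_lincomb(2) intro: relator_in_ideal)
  next
    case (prod k F q G)
    note F = prod(2) and G = prod(3)
    note dF = admissible_jet_der[OF F] and dG = admissible_jet_der[OF G]
    have g: "admissible (Suc (k + q)) (insertion (Suc k) (jet_der F) G)" "admissible (Suc (k + q)) (insertion k F (jet_der G))"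
      using admissible_insertion[OF dF G] admissible_insertion[OF F dG] by simp_all
    have d: "jet_der (insertion k F G) = (\<lambda>M. scale 1 (insertion (Suc k) (jet_der F) G M) + insertion k F (jet_der G) M)"
      by (simp add: jet_der_insertion[OF F G] fun_eq_iff)
    have "mpoly_der letter_der r = (letter (Suc (Suc k), jet_der F) * letter (q, G) - letter (Suc k + q, insertion (Suc k) (jet_der F) G))
        + (letter (Suc k, F) * letter (Suc q, jet_der G) - letter (k + Suc q, insertion k F (jet_der G)))
        - (letter (Suc (k + q), jet_der (insertion k F G))
           - pscale 1 (letter (Suc (k + q), insertion (Suc k) (jet_der F) G)) - letter (Suc (k + q), insertion k F (jet_der G)))"
      by (simp add: prod(1) D.diff mpoly_der_mult mpoly_der_letter)
    also have "\<dots> \<in> relator_ideal"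
      unfolding d using relators.prod[OF dF G] relators.prod[OF F dG] relators.lin[OF g, of 1]
      by (intro pm.subspace_add[OF subspace_relator_ideal] pm.subspace_diff[OF subspace_relator_ideal] relator_in_ideal(2))
    finally show ?thesis .
  qed
qed

lemma mpoly_der_relator_ideal: "v \<in> relator_ideal \<Longrightarrow> mpoly_der letter_der v \<in> relator_ideal"
proof -
  interpret D: Vector_Spaces.linear pscale pscale "mpoly_der letter_der" by (rule linear_mpoly_der)
  show "v \<in> relator_ideal \<Longrightarrow> mpoly_der letter_der v \<in> relator_ideal"
    unfolding relator_ideal_def
  proof (induction rule: pm.span_induct_alt)
    case (step c x y)
    then obtain w r where x: "x = w * r" and r: "r \<in> relators" by blast
    have "mpoly_der letter_der x \<in> relator_ideal"
      unfolding x mpoly_der_mult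
      by (intro pm.subspace_add[OF subspace_relator_ideal] relator_ideal_mult[OF mpoly_der_relators[OF r]] relator_in_ideal(1)[OF r])
    with step show ?case
      unfolding D.add D.scale by (auto intro: pm.span_add pm.span_scale simp: relator_ideal_def)
  qed (simp add: pm.span_zero D.zero)
qed

section \<open>Evaluation of monomials\<close>

text \<open>Iterated insertion starting from \<open>ident\<close>. A map of degree
  \<open>k + 1\<close> is inserted into with parameter \<open>k\<close>, hence
  \<open>fst l - 1\<close>.\<close>

definition letter_prod :: "(nat \<times> ('n multiset \<Rightarrow> 'n)) list \<Rightarrow> 'n multiset \<Rightarrow> 'n" where
  "letter_prod ls = foldr (\<lambda>l. insertion (fst l - 1) (snd l)) ls ident"

definition positive_letter :: "nat \<times> ('n multiset \<Rightarrow> 'n) \<Rightarrow> bool" where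
  "positive_letter l \<longleftrightarrow> fst l \<noteq> 0 \<and> admissible (fst l) (snd l)"

lemma letter_prod_simps [simp]:
  "letter_prod [] = ident" "letter_prod (l # ls) = insertion (fst l - 1) (snd l) (letter_prod ls)"
  by (simp_all add: letter_prod_def)

lemma admissible_letter_prod: "\<forall>l\<in>set ls. positive_letter l \<Longrightarrow> \<exists>n. admissible (Suc n) (letter_prod ls)"
proof (induction ls)
  case Nil
  then show ?case using admissible_ident by auto
next
  case (Cons l ls)
  then obtain n where "admissible (Suc n) (letter_prod ls)" by auto
  moreover obtain k where "fst l = Suc k" using Cons.prems by (cases "fst l") (auto simp: positive_letter_def)
  ultimately have "admissible (k + Suc n) (letter_prod (l # ls))"
    using Cons.prems admissible_insertion[of k "snd l" "Suc n" "letter_prod ls"] by (simp add: positive_letter_def)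
  then show ?case by auto
qed

lemma letter_prod_insert:
  "\<forall>l\<in>set (us @ a # vs). positive_letter l \<Longrightarrow> letter_prod (us @ a # vs) = letter_prod (a # us @ vs)"
proof (induction us)
  case (Cons u us)
  obtain n where n: "admissible (Suc n) (letter_prod (us @ vs))" using admissible_letter_prod[of "us @ vs"] Cons.prems by auto
  have "admissible (Suc (fst u - 1)) (snd u)" "admissible (Suc (fst a - 1)) (snd a)"
    using Cons.prems by (auto simp: positive_letter_def)
  from insertion_left_commute[OF this n] Cons show ?case by simp
qed simp

lemma letter_prod_perm:
  "mset ls = mset ls' \<Longrightarrow> \<forall>l\<in>set ls. positive_letter l \<Longrightarrow> letter_prod ls = letter_prod ls'"
proof (induction ls arbitrary: ls')
  case (Cons a ls)
  have "a \<in> set ls'" using Cons.prems(1) by (metis list.set_intros(1) mset_eq_setD)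
  then obtain us vs where ls': "ls' = us @ a # vs" by (meson split_list)
  have "set ls' = set (a # ls)" using Cons.prems(1) by (metis mset_eq_setD)
  with Cons.prems(2) have "letter_prod ls' = letter_prod (a # us @ vs)"
    unfolding ls' by (intro letter_prod_insert) simp
  moreover have "letter_prod ls = letter_prod (us @ vs)"
    using Cons by (intro Cons.IH) (auto simp: ls')
  ultimately show ?case by simp
qed simp

definition zeros :: "(nat \<times> ('n multiset \<Rightarrow> 'n)) multiset \<Rightarrow> 'n multiset" where
  "zeros m = image_mset (\<lambda>l. snd l {#}) {#l \<in># m. fst l = 0#}"

text \<open>Letters are arbitrary pairs; a monomial with an inadmissible one goes to 0, which is
  harmless as relators contain admissible letters only. Otherwise the order of the factors is
  irrelevant by \<open>letter_prod_perm\<close>.\<close>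

definition eval_monomial :: "(nat \<times> ('n multiset \<Rightarrow> 'n)) multiset \<Rightarrow> 'n" where
  "eval_monomial m = (if \<forall>l\<in>#m. admissible (fst l) (snd l)
     then letter_prod (SOME ls. mset ls = {#l \<in># m. fst l \<noteq> 0#}) (zeros m) else 0)"

lemma eval_monomial_eq:
  assumes "\<forall>l\<in>#m. admissible (fst l) (snd l)" "mset ls = {#l \<in># m. fst l \<noteq> 0#}"
  shows "eval_monomial m = letter_prod ls (zeros m)"
proof -
  let ?ls = "SOME ls. mset ls = {#l \<in># m. fst l \<noteq> 0#}"
  have "mset ?ls = {#l \<in># m. fst l \<noteq> 0#}" by (rule someI_ex) (use assms(2) in blast)
  moreover have "\<forall>l\<in>set ls. positive_letter l"
    using assms(1) arg_cong[OF assms(2), of set_mset] by (auto simp: positive_letter_def)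
  ultimately have "letter_prod ls = letter_prod ?ls" using assms by (intro letter_prod_perm) auto
  with assms show ?thesis by (simp add: eval_monomial_def)
qed

lemma eval_monomial_bad: "\<not> (\<forall>l\<in>#m. admissible (fst l) (snd l)) \<Longrightarrow> eval_monomial (add_mset l m) = 0"
  by (auto simp: eval_monomial_def)

text \<open>\<open>H\<close> is the product of the positive letters of \<open>m\<close>. A further
  positive letter becomes an insertion, a letter of degree 0 an argument; the shapes listed are
  those occurring in multiples of relators.\<close>

lemma eval_monomial_decompose:
  assumes m: "\<forall>l\<in>#m. admissible (fst l) (snd l)"
  obtains n H where "admissible (Suc n) H"
    "\<And>x. eval_monomial (add_mset (0, const x) m) = H (add_mset x (zeros m))"
    "\<And>k F. admissible (Suc k) F \<Longrightarrow> eval_monomial (add_mset (Suc k, F) m) = insertion k F H (zeros m)"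
    "\<And>k F x. admissible (Suc k) F \<Longrightarrow>
       eval_monomial (add_mset (Suc k, F) (add_mset (0, const x) m)) = insertion k F H (add_mset x (zeros m))"
    "\<And>k F l G. admissible (Suc k) F \<Longrightarrow> admissible (Suc l) G \<Longrightarrow>
       eval_monomial (add_mset (Suc k, F) (add_mset (Suc l, G) m)) = insertion k F (insertion l G H) (zeros m)"
proof -
  obtain ls where ls: "mset ls = {#l \<in># m. fst l \<noteq> 0#}" using ex_mset by metis
  have "\<forall>l\<in>set ls. positive_letter l"
    using m arg_cong[OF ls, of set_mset] by (auto simp: positive_letter_def)
  then obtain n where "admissible (Suc n) (letter_prod ls)" using admissible_letter_prod by blast
  then show thesis
  proof (rule that)
    show "eval_monomial (add_mset (0, const x) m) = letter_prod ls (add_mset x (zeros m))" for x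
      using eval_monomial_eq[of "add_mset (0, const x) m" ls] m ls admissible_const[of x] by (simp add: zeros_def const_def)
    show "eval_monomial (add_mset (Suc k, F) m) = insertion k F (letter_prod ls) (zeros m)" if "admissible (Suc k) F" for k F
      using eval_monomial_eq[of "add_mset (Suc k, F) m" "(Suc k, F) # ls"] m ls that by (simp add: zeros_def)
    show "eval_monomial (add_mset (Suc k, F) (add_mset (0, const x) m)) = insertion k F (letter_prod ls) (add_mset x (zeros m))"
      if "admissible (Suc k) F" for k F x
      using eval_monomial_eq[of "add_mset (Suc k, F) (add_mset (0, const x) m)" "(Suc k, F) # ls"] m ls that admissible_const[of x]
      by (simp add: zeros_def const_def)
    show "eval_monomial (add_mset (Suc k, F) (add_mset (Suc l, G) m)) = insertion k F (insertion l G (letter_prod ls)) (zeros m)"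
      if "admissible (Suc k) F" "admissible (Suc l) G" for k F l G
      using eval_monomial_eq[of "add_mset (Suc k, F) (add_mset (Suc l, G) m)" "(Suc k, F) # (Suc l, G) # ls"] m ls that
      by (simp add: zeros_def)
  qed
qed

lemma eval_monomial_insertion:
  assumes F: "admissible (Suc k) F" and G: "admissible q G"
  shows "eval_monomial (add_mset (Suc k, F) (add_mset (q, G) m)) = eval_monomial (add_mset (k + q, insertion k F G) m)"
proof (cases "\<forall>l\<in>#m. admissible (fst l) (snd l)")
  case False
  then show ?thesis using eval_monomial_bad[OF False] by (auto simp: eval_monomial_def)
next
  case True
  then obtain n H where H: "admissible (Suc n) H"
    and e: "\<And>x. eval_monomial (add_mset (0, const x) m) = H (add_mset x (zeros m))"
    "\<And>k F. admissible (Suc k) F \<Longrightarrow> eval_monomial (add_mset (Suc k, F) m) = insertion k F H (zeros m)"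
    "\<And>k F x. admissible (Suc k) F \<Longrightarrow>
       eval_monomial (add_mset (Suc k, F) (add_mset (0, const x) m)) = insertion k F H (add_mset x (zeros m))"
    "\<And>k F l G. admissible (Suc k) F \<Longrightarrow> admissible (Suc l) G \<Longrightarrow>
       eval_monomial (add_mset (Suc k, F) (add_mset (Suc l, G) m)) = insertion k F (insertion l G H) (zeros m)"
    by - (rule eval_monomial_decompose[OF True], rule that; assumption)
  note FG = admissible_insertion[OF F G]
  show ?thesis
  proof (cases q)
    case (Suc l)
    with G have G': "admissible (Suc l) G" by simp
    have "admissible (Suc (k + l)) (insertion k F G)" using FG Suc by simp
    then show ?thesis using e(4)[OF F G'] e(2) insertion_assoc[OF F G' H] Suc by simp
  next
    case 0
    with G obtain x where x: "G = const x" using admissible_zero_eq_const by blast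
    \<comment> \<open>The argument \<open>x\<close> is fed to the product of \<open>H\<close> and
      \<open>F\<close>; with \<open>H\<close> in front, associativity passes it on to
      \<open>F\<close>.\<close>
    have HF: "admissible (n + Suc k) (insertion n H F)" by (rule admissible_insertion[OF H F])
    have "eval_monomial (add_mset (Suc k, F) (add_mset (q, G) m)) = insertion n H F (add_mset x (zeros m))"
      by (simp add: 0 x e(3)[OF F] insertion_commute[OF F H])
    also have "\<dots> = insertion (n + k) (insertion n H F) (const x) (zeros m)"
      using HF insertion_const[of "n + k"] by simp
    also have "\<dots> = insertion n H (insertion k F G) (zeros m)"
      by (simp add: x insertion_assoc[OF H F admissible_const])
    also have "\<dots> = eval_monomial (add_mset (k + q, insertion k F G) m)"
    \<comment> \<open>For \<open>k = 0\<close> the insertion is itself an element of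
      \<open>N\<close>, hence an argument of \<open>H\<close> and not a factor.\<close>
    proof (cases k)
      case k: 0
      then obtain y where "insertion k F G = const y" using FG 0 admissible_zero_eq_const by auto
      then show ?thesis using e(1)[of y] insertion_const[OF H] 0 k by simp
    next
      case k: (Suc k')
      then have g: "admissible (Suc k') (insertion k F G)" using FG 0 by simp
      then show ?thesis using e(2)[OF g] insertion_commute[OF H g] 0 k by simp
    qed
    finally show ?thesis .
  qed
qed

text \<open>In degree 0 this is linearity of \<open>H\<close> in an argument; in positive degree it
  holds pointwise, since the \<open>X\<close> chosen by \<open>insertion\<close> does not depend on
  \<open>F\<close>.\<close>

lemma eval_monomial_lin:
  assumes F: "admissible p F" and G: "admissible p G"
  shows "eval_monomial (add_mset (p, \<lambda>M. scale c (F M) + G M) m)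
    = scale c (eval_monomial (add_mset (p, F) m)) + eval_monomial (add_mset (p, G) m)"
proof (cases "\<forall>l\<in>#m. admissible (fst l) (snd l)")
  case False
  then show ?thesis using eval_monomial_bad[OF False] by simp
next
  case True
  then obtain n H where H: "admissible (Suc n) H"
    and e: "\<And>x. eval_monomial (add_mset (0, const x) m) = H (add_mset x (zeros m))"
    "\<And>k F. admissible (Suc k) F \<Longrightarrow> eval_monomial (add_mset (Suc k, F) m) = insertion k F H (zeros m)"
    by - (rule eval_monomial_decompose[OF True], rule that; assumption)
  show ?thesis
  proof (cases p)
    case 0
    with F G obtain x y where "F = const x" "G = const y" using admissible_zero_eq_const by metis
    moreover have "(\<lambda>M. scale c (const x M) + const y M) = const (scale c x + y)"
      by (auto simp: const_def)
    ultimately show ?thesis by (simp add: 0 e admissible_arg[OF H])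
  next
    case (Suc k)
    with admissible_lincomb(1)[OF F G] have "admissible (Suc k) (\<lambda>M. scale c (F M) + G M)" by simp
    with F G Suc show ?thesis by (simp add: e insertion_def Let_def)
  qed
qed

definition evaluation :: "((nat \<times> ('n multiset \<Rightarrow> 'n)) multiset \<Rightarrow>\<^sub>0 'k) \<Rightarrow> 'n" where
  "evaluation = pm_extend scale eval_monomial"

lemma linear_evaluation: "Vector_Spaces.linear pscale scale evaluation"
  unfolding evaluation_def by (rule linear_pm_extend)

lemma evaluation_monom: "evaluation (Poly_Mapping.single m 1) = eval_monomial m"
  by (simp add: evaluation_def)

lemma evaluation_relators:
  assumes "r \<in> relators" shows "evaluation (u * r) = 0"
proof -
  interpret E: Vector_Spaces.linear pscale scale evaluation by (rule linear_evaluation)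
  have "evaluation (Poly_Mapping.single m 1 * r) = 0" for m
    using assms
  proof cases
    case (lin p F G c)
    then show ?thesis
      by (simp add: right_diff_distrib pscale_mult E.diff E.scale letter_def mult_single evaluation_monom eval_monomial_lin
          del: pscale_single)
  next
    case (prod k F q G)
    then show ?thesis
      by (simp add: right_diff_distrib E.diff letter_def mult_single evaluation_monom eval_monomial_insertion[symmetric] add_mset_commute)
  qed
  moreover have "pm.subspace {u. evaluation (u * r) = 0}"
    unfolding pm.subspace_def
    by (simp add: distrib_right pscale_mult(1) E.add E.scale E.zero)
  ultimately have "u \<in> {u. evaluation (u * r) = 0}"
    by - (rule pm_subspace_UNIV, simp_all)
  then show ?thesis by simp
qed

lemma evaluation_relator_ideal: "v \<in> relator_ideal \<Longrightarrow> evaluation v = 0"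
proof -
  interpret E: Vector_Spaces.linear pscale scale evaluation by (rule linear_evaluation)
  show "v \<in> relator_ideal \<Longrightarrow> evaluation v = 0"
    unfolding relator_ideal_def
    by (induction rule: pm.span_induct_alt) (auto simp: E.zero E.add E.scale evaluation_relators)
qed

section \<open>The quotient by the relators as a differential commutative algebra\<close>

theorem embeds_in_differential_comm_algebra:
  "\<exists>mult d (j :: 'n \<Rightarrow> (nat \<times> ('n multiset \<Rightarrow> 'n)) multiset \<Rightarrow>\<^sub>0 'k).
     differential_comm_algebra pscale mult d \<and> Vector_Spaces.linear scale pscale j \<and> inj j \<and>
     (\<forall>x y. j (x \<circ>\<^sub>N y) = mult (j x) (d (j y)))"
proof -
  obtain \<pi> where "Vector_Spaces.linear pscale pscale \<pi> \<and> (\<forall>u. \<pi> u = 0 \<longleftrightarrow> u \<in> relator_ideal) \<and> (\<forall>u. u - \<pi> u \<in> relator_ideal)"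
    using pm.exists_projection[OF subspace_relator_ideal] by (rule exE)
  then have \<pi>: "Vector_Spaces.linear pscale pscale \<pi>"
    and ker: "\<And>u. \<pi> u = 0 \<longleftrightarrow> u \<in> relator_ideal" and diff: "\<And>u. u - \<pi> u \<in> relator_ideal"
    by simp_all
  interpret p: Vector_Spaces.linear pscale pscale \<pi> by (rule \<pi>)
  interpret D: Vector_Spaces.linear pscale pscale "mpoly_der letter_der" by (rule linear_mpoly_der)
  have eq: "\<pi> u = \<pi> v \<longleftrightarrow> u - v \<in> relator_ideal" for u v
    using ker[of "u - v"] by (simp add: p.diff)
  \<comment> \<open>Multiplication and derivation preserve \<open>relator_ideal\<close>, so an inner
    \<open>\<pi>\<close> is invisible under an outer one.\<close>
  have m1: "\<pi> (u * \<pi> v) = \<pi> (u * v)" for u v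
    using pm.subspace_neg[OF subspace_relator_ideal relator_ideal_mult[OF diff, of u v]] by (simp add: eq algebra_simps)
  have m2: "\<pi> (\<pi> u * v) = \<pi> (u * v)" for u v
    using m1[of v u] by (simp add: mult.commute)
  have d: "\<pi> (mpoly_der letter_der (\<pi> u)) = \<pi> (mpoly_der letter_der u)" for u
    using pm.subspace_neg[OF subspace_relator_ideal mpoly_der_relator_ideal[OF diff, of u]] by (simp add: eq D.diff)
  let ?m = "\<lambda>u v. \<pi> (u * v)" and ?d = "\<lambda>u. \<pi> (mpoly_der letter_der u)" and ?j = "\<lambda>x. \<pi> (letter (0, const x))"
  have "differential_comm_algebra pscale ?m ?d"
  proof (intro differential_comm_algebra.intro differential_comm_algebra_axioms.intro pm.vector_space_axioms)
    show "bilinear_op pscale ?m"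
      by (simp add: pm.bilinear_op_iff distrib_left distrib_right pscale_mult p.add p.scale)
    show "Vector_Spaces.linear pscale pscale ?d"
      by (simp add: pm.linear_self_iff p.add p.scale D.add D.scale)
    show "?m (?m u v) w = ?m u (?m v w)" "?m u v = ?m v u" for u v w
      by (simp_all add: m1 m2 mult.assoc) (simp add: mult.commute)
    show "?d (?m u v) = ?m (?d u) v + ?m u (?d v)" for u v
      by (simp add: m1 m2 d mpoly_der_mult p.add)
  qed
  moreover have j: "Vector_Spaces.linear scale pscale ?j"
  proof -
    have l: "?j (scale c x + y) = pscale c (?j x) + ?j y" for c x y
    proof -
      have "const (scale c x + y) = (\<lambda>M. scale c (const x M) + const y M)"
        by (auto simp: const_def)
      then show ?thesis
        using relator_in_ideal(2)[OF relators.lin[OF admissible_const admissible_const]]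
        by (simp add: p.add[symmetric] p.scale[symmetric] eq algebra_simps)
    qed
    have "?j 0 = 0" using l[of 1 0 0] by simp
    then have "?j (x + y) = ?j x + ?j y" "?j (scale c x) = pscale c (?j x)" for c x y
      using l[of 1 x y] l[of c x 0] by simp_all
    then show ?thesis
      by (simp add: Vector_Spaces.linear_iff vector_space_axioms pm.vector_space_axioms)
  qed
  moreover have "inj ?j"
  proof -
    interpret j: Vector_Spaces.linear scale pscale ?j by (rule j)
    have "x = 0" if "?j x = 0" for x
    proof -
      \<comment> \<open>No letter here has positive degree, so the product is \<open>ident\<close>
        and returns \<open>x\<close>, while \<open>evaluation\<close> kills the ideal.\<close>
      have "x = eval_monomial {#(0, const x)#}"
        using eval_monomial_eq[of "{#(0, const x)#}" "[]"] admissible_const[of x]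
        by (simp add: zeros_def const_def ident_simps)
      also have "\<dots> = 0" using that evaluation_relator_ideal by (simp add: ker letter_def evaluation_monom[symmetric])
      finally show ?thesis .
    qed
    then show ?thesis by (simp add: j.inj_iff_eq_0)
  qed
  moreover have "?j (x \<circ>\<^sub>N y) = ?m (?j x) (?d (?j y))" for x y
  proof -
    \<comment> \<open>The relator \<open>prod\<close> with \<open>k\<close> and \<open>q\<close>
      both 0: the derivative of \<open>y\<close> has degree 1, and inserting \<open>x\<close> into
      it leaves the element \<open>x \<circ>\<^sub>N y\<close>.\<close>
    have g: "admissible (Suc 0) (jet_der (const y))" using admissible_jet_der[OF admissible_const] .
    have "insertion 0 (jet_der (const y)) (const x) = const (insertion 0 (jet_der (const y)) (const x) {#})"
      using admissible_insertion[OF g admissible_const] by (intro admissible_zero_eq_const) simp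
    then have "insertion 0 (jet_der (const y)) (const x) = const (x \<circ>\<^sub>N y)"
      by (simp add: insertion_const[OF g] jet_der_const)
    then have "letter (Suc 0, jet_der (const y)) * letter (0, const x) - letter (0, const (x \<circ>\<^sub>N y)) \<in> relator_ideal"
      using relator_in_ideal(2)[OF relators.prod[OF g admissible_const[of x]]] by simp
    then show ?thesis by (simp add: m1 m2 d mpoly_der_letter eq[symmetric] mult.commute)
  qed
  ultimately show ?thesis by blast
qed

end

section \<open>From commutative algebras to Perm-algebras\<close>

definition pair_scale :: "('k \<Rightarrow> 'a \<Rightarrow> 'a) \<Rightarrow> 'k \<Rightarrow> 'a \<times> 'a \<Rightarrow> 'a \<times> 'a" where
  "pair_scale scale c z = (scale c (fst z), scale c (snd z))"

lemma pair_scale_simp [simp]: "pair_scale scale c (x, y) = (scale c x, scale c y)"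
  by (simp add: pair_scale_def)

lemma (in vector_space) vector_space_pair_scale: "vector_space (pair_scale scale)"
  by unfold_locales (auto simp: pair_scale_def algebra_simps)

text \<open>A left factor acts through its first component only, and first components commute; this
  is the Perm identity.\<close>

lemma (in differential_comm_algebra) differential_perm_algebra_pair:
  "differential_perm_algebra (pair_scale scale)
     (\<lambda>u v. (fst u \<cdot> fst v, fst u \<cdot> snd v)) (\<lambda>u. (d (fst u), d (snd u)))"
proof -
  interpret p: vector_space "pair_scale scale" by (rule vector_space_pair_scale)
  interpret D: Vector_Spaces.linear scale scale d by (rule linear_d)
  note b = bilinear_opD[OF bilinear_mult]
  show ?thesis
  proof (intro differential_perm_algebra.intro perm_algebra.intro perm_algebra_axioms.intro
      differential_perm_algebra_axioms.intro p.vector_space_axioms)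
    show "bilinear_op (pair_scale scale) (\<lambda>u v. (fst u \<cdot> fst v, fst u \<cdot> snd v))"
      by (auto simp: p.bilinear_op_iff pair_scale_def b)
    show "Vector_Spaces.linear (pair_scale scale) (pair_scale scale) (\<lambda>u. (d (fst u), d (snd u)))"
      by (auto simp: p.linear_self_iff pair_scale_def D.add D.scale)
  qed (simp_all add: assoc derivation comm[of "fst x" "fst y" for x y :: "'p \<times> 'p"])
qed

section \<open>Transport of a differential Perm-algebra to the type \<open>envelope\<close>\<close>

context differential_perm_algebra
begin

text \<open>No unit is assumed, so the empty word goes to 0, and \<open>word_append\<close> is
  confined to nonempty words.\<close>

fun word :: "('l \<Rightarrow> 'p) \<Rightarrow> 'l list \<Rightarrow> 'p" where
  "word g [] = 0"
| "word g [l] = g l"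
| "word g (l # l' # ls) = g l \<cdot> word g (l' # ls)"

lemma word_append: "us \<noteq> [] \<Longrightarrow> vs \<noteq> [] \<Longrightarrow> word g (us @ vs) = word g us \<cdot> word g vs"
proof (induction g us rule: word.induct)
  case (2 g l)
  then show ?case by (cases vs) auto
qed (auto simp: assoc)

theorem transfer_to_envelope:
  fixes \<theta> :: "'n::ab_group_add \<Rightarrow> 'p" and scaleN :: "'k \<Rightarrow> 'n \<Rightarrow> 'n"
  assumes \<theta>: "Vector_Spaces.linear scaleN scale \<theta>" "inj \<theta>"
    and vdash: "\<And>x y. \<theta> (vdash x y) = \<theta> x \<cdot> d (\<theta> y)"
    and dashv: "\<And>x y. \<theta> (dashv x y) = d (\<theta> y) \<cdot> \<theta> x"
  shows "\<exists>(scaleP :: 'k \<Rightarrow> ('n, 'k) envelope \<Rightarrow> ('n, 'k) envelope) mult' d' \<theta>'.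
    differential_perm_algebra scaleP mult' d' \<and> Vector_Spaces.linear scaleN scaleP \<theta>' \<and> inj \<theta>' \<and>
    (\<forall>x y. \<theta>' (vdash x y) = mult' (\<theta>' x) (d' (\<theta>' y))) \<and>
    (\<forall>x y. \<theta>' (dashv x y) = mult' (d' (\<theta>' y)) (\<theta>' x))"
proof -
  \<comment> \<open>The symbol \<open>(i, x)\<close> stands for the \<open>i\<close>-th derivative
    of \<open>\<theta> x\<close>. The range of \<open>q\<close> is then shown to be closed under
    products and \<open>d\<close>, first on words and then by linearity.\<close>
  define g where "g l = (d ^^ fst l) (\<theta> (snd l))" for l :: "nat \<times> 'n"
  define q where "q = pm_extend scale (word g)"
  have lq: "Vector_Spaces.linear pscale scale q" unfolding q_def by (rule linear_pm_extend)
  interpret q: Vector_Spaces.linear pscale scale q by (rule lq)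
  interpret D: Vector_Spaces.linear scale scale d by (rule linear_d)
  interpret T: Vector_Spaces.linear scaleN scale \<theta> by (rule \<theta>(1))
  note b = bilinear_opD[OF bilinear_mult]
  have R: "subspace (range q)" using q.subspace_image[OF pm.subspace_UNIV] .
  have q1: "q (Poly_Mapping.single ls 1) = word g ls" for ls by (simp add: q_def)
  have wR: "word g ls \<in> range q" for ls using q1 by (metis rangeI)
  have ww: "word g us \<cdot> word g vs \<in> range q" for us vs
    using word_append[of us vs g] wR[of "us @ vs"] wR[of "[]"] by (cases "us = [] \<or> vs = []") (auto simp: b)
  have "pm.subspace {v. word g us \<cdot> q v \<in> range q}" for us
    unfolding pm.subspace_def
    using subspace_0[OF R] subspace_add[OF R] subspace_scale[OF R] by (simp add: q.zero q.add q.scale b)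
  then have "v \<in> {v. word g us \<cdot> q v \<in> range q}" for us v
    by (rule pm_subspace_UNIV) (simp add: q1 ww)
  then have wq: "word g us \<cdot> q v \<in> range q" for us v by simp
  have "pm.subspace {u. q u \<cdot> q v \<in> range q}" for v
    unfolding pm.subspace_def
    using subspace_0[OF R] subspace_add[OF R] subspace_scale[OF R] by (simp add: q.zero q.add q.scale b)
  then have "u \<in> {u. q u \<cdot> q v \<in> range q}" for u v
    by (rule pm_subspace_UNIV) (simp add: q1 wq)
  then have mR: "q u \<cdot> q v \<in> range q" for u v by simp
  have dg: "d (g l) \<in> range q" for l
    using wR[of "[(Suc (fst l), snd l)]"] by (simp add: g_def)
  have dw: "d (word g ls) \<in> range q" for ls
  proof (induction ls rule: induct_list012)
    case (3 l l' ls)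
    have "d (g l) \<cdot> word g (l' # ls) \<in> range q" "g l \<cdot> d (word g (l' # ls)) \<in> range q"
      using mR dg[of l] 3 wR[of "[l]"] wR[of "l' # ls"] by fastforce+
    then show ?case by (auto simp: derivation intro: subspace_add[OF R])
  qed (use dg wR[of "[]"] in \<open>simp_all add: D.zero\<close>)
  have "pm.subspace {u. d (q u) \<in> range q}"
    unfolding pm.subspace_def
    using subspace_0[OF R] subspace_add[OF R] subspace_scale[OF R]
    by (simp add: q.zero q.add q.scale D.zero D.add D.scale)
  then have "u \<in> {u. d (q u) \<in> range q}" for u
    by (rule pm_subspace_UNIV) (simp add: q1 dw)
  then have dR: "d (q u) \<in> range q" for u by simp
  have \<theta>R: "\<theta> x \<in> range q" for x using wR[of "[(0, x)]"] by (simp add: g_def)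

  \<comment> \<open>The section satisfies \<open>q (s v) = v\<close> only on the range of
    \<open>q\<close>, which is why the closure facts above are needed.\<close>
  have "\<exists>s. range s \<subseteq> UNIV \<and> Vector_Spaces.linear scale pscale s \<and> (\<forall>v\<in>range q. q (s v) = v)"
    using lq pm.subspace_UNIV
    by (intro vector_space_pair.linear_exists_right_inverse_on vector_space_pair.intro
        vector_space_axioms pm.vector_space_axioms)
  then obtain s where s: "Vector_Spaces.linear scale pscale s" and qs: "\<And>v. v \<in> range q \<Longrightarrow> q (s v) = v"
    by blast
  interpret s: Vector_Spaces.linear scale pscale s by (rule s)
  let ?m = "\<lambda>u v. s (q u \<cdot> q v)" and ?d = "\<lambda>u. s (d (q u))" and ?\<theta> = "\<lambda>x. s (\<theta> x)"
  have "differential_perm_algebra pscale ?m ?d"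
  proof (intro differential_perm_algebra.intro perm_algebra.intro perm_algebra_axioms.intro
      differential_perm_algebra_axioms.intro pm.vector_space_axioms)
    show "bilinear_op pscale ?m"
      by (simp add: pm.bilinear_op_iff q.add q.scale b s.add s.scale)
    show "Vector_Spaces.linear pscale pscale ?d"
      by (simp add: pm.linear_self_iff q.add q.scale D.add D.scale s.add s.scale)
    show "?m (?m x y) z = ?m x (?m y z)" "?m (?m x y) z = ?m (?m y x) z" for x y z
      by (simp add: qs mR assoc, simp only: qs mR perm[of "q x" "q y"])
    show "?d (?m x y) = ?m (?d x) y + ?m x (?d y)" for x y
      by (simp add: qs mR dR derivation s.add)
  qed
  moreover have "Vector_Spaces.linear scaleN pscale ?\<theta>"
    by (simp add: Vector_Spaces.linear_iff T.vs1.vector_space_axioms pm.vector_space_axioms T.add T.scale s.add s.scale)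
  moreover have "inj ?\<theta>"
    using qs \<theta>R \<theta>(2) by (metis (no_types, lifting) injD injI)
  moreover have "?\<theta> (vdash x y) = ?m (?\<theta> x) (?d (?\<theta> y))" "?\<theta> (dashv x y) = ?m (?d (?\<theta> y)) (?\<theta> x)" for x y
  proof -
    have "d (\<theta> y) \<in> range q" using dR \<theta>R[of y] by auto
    then show "?\<theta> (vdash x y) = ?m (?\<theta> x) (?d (?\<theta> y))" "?\<theta> (dashv x y) = ?m (?d (?\<theta> y)) (?\<theta> x)"
      by (simp_all add: qs \<theta>R vdash dashv)
  qed
  ultimately show ?thesis by blast
qed

end

section \<open>Embedding a Novikov dialgebra\<close>

context novikov_dialgebra
begin

section \<open>The span of all \<open>x \<turnstile> y - x \<stileturn> y\<close> and the split null
  extension\<close>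

lemmas vdash_simps = bilinear_opD[OF bilinear_vdash]
lemmas dashv_simps = bilinear_opD[OF bilinear_dashv]

definition diff_span :: "'n set" where
  "diff_span = span {x \<turnstile> y - x \<stileturn> y | x y. True}"

lemma diff_in_diff_span: "x \<turnstile> y - x \<stileturn> y \<in> diff_span"
  unfolding diff_span_def by (rule span_base) blast

text \<open>On generators these are the 0-identities. They let the quotient act on \<open>N\<close>
  from the left by \<turnstile> and from the right by \<stileturn>.\<close>

lemma diff_span_annihilates:
  assumes "w \<in> diff_span" shows "w \<turnstile> z = 0" "z \<stileturn> w = 0"
proof -
  have "w \<turnstile> z = 0 \<and> z \<stileturn> w = 0"
    using assms unfolding diff_span_def
  proof (induction rule: span_induct_alt)
    case (step c x y)
    then obtain a b where "x = a \<turnstile> b - a \<stileturn> b" by blast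
    then have "x \<turnstile> z = 0" "z \<stileturn> x = 0"
      by (simp_all add: vdash_simps dashv_simps zero_vdash zero_dashv)
    with step show ?case by (simp add: vdash_simps dashv_simps)
  qed (simp add: vdash_simps dashv_simps)
  then show "w \<turnstile> z = 0" "z \<stileturn> w = 0" by simp_all
qed

text \<open>The difference of the two left symmetry laws writes the product as a combination of
  generators. Together with \<open>diff_span_annihilates\<close> this makes \<open>diff_span\<close>
  an ideal for \<turnstile>.\<close>

lemma vdash_diff_span:
  assumes "w \<in> diff_span" shows "z \<turnstile> w \<in> diff_span"
  using assms unfolding diff_span_def
proof (induction rule: span_induct_alt)
  case base
  then show ?case by (simp add: vdash_simps span_zero)
next
  case (step c w' y)
  then obtain a b where w': "w' = a \<turnstile> b - a \<stileturn> b" by blast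
  have "z \<turnstile> w' = ((z \<turnstile> a) \<turnstile> b - (z \<turnstile> a) \<stileturn> b) - ((a \<stileturn> z) \<turnstile> b - (a \<stileturn> z) \<stileturn> b)
      + (a \<turnstile> (z \<turnstile> b) - a \<stileturn> (z \<turnstile> b))"
    using left_symmetric_vdash[of z a b] left_symmetric_dashv[of a z b] zero_dashv[of a z b] zero_vdash[of a z b]
    unfolding w' vdash_simps by (simp add: algebra_simps)
  also have "\<dots> \<in> diff_span"
    unfolding diff_span_def
    by (intro span_add span_diff diff_in_diff_span[unfolded diff_span_def])
  finally show ?case
    using step by (simp add: vdash_simps diff_span_def span_add span_scale)
qed

text \<open>
  With \<open>N\<^sub>0\<close> the quotient of \<open>N\<close> by the span of all \<open>x \<turnstile> y - x \<stileturn> y\<close>, this is the split null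
  extension of the Novikov algebra \<open>N\<^sub>0\<close> by its bimodule \<open>N\<close>; the quotient is realised by a
  projection along that span.
\<close>

lemma split_null_extension:
  assumes \<pi>: "Vector_Spaces.linear scale scale \<pi>" "\<And>x. \<pi> x = 0 \<longleftrightarrow> x \<in> diff_span"
    "\<And>x. x - \<pi> x \<in> diff_span"
  shows "novikov_algebra (pair_scale scale)
    (\<lambda>u v. (\<pi> (fst u \<turnstile> fst v), fst u \<turnstile> snd v + snd u \<stileturn> fst v))"
proof -
  interpret p: vector_space "pair_scale scale" by (rule vector_space_pair_scale)
  interpret P: Vector_Spaces.linear scale scale \<pi> by (rule \<pi>(1))
  have eq: "\<pi> x = \<pi> y" if "x - y \<in> diff_span" for x y
    using \<pi>(2)[of "x - y"] that by (simp add: P.diff)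
  have 1: "\<pi> x \<turnstile> y = x \<turnstile> y" "y \<stileturn> \<pi> x = y \<stileturn> x" for x y
    using diff_span_annihilates[OF \<pi>(3)[of x], of y] by (simp_all add: vdash_simps dashv_simps)
  have 2: "\<pi> (x \<turnstile> \<pi> y) = \<pi> (x \<turnstile> y)" for x y
    using vdash_diff_span[OF \<pi>(3)[of y], of x] by (intro eq[symmetric]) (simp add: vdash_simps)
  \<comment> \<open>The law for \<turnstile> mixes both operations; they agree modulo
    \<open>diff_span\<close>.\<close>
  have 3: "\<pi> ((x \<turnstile> y) \<turnstile> z) = \<pi> ((x \<turnstile> z) \<turnstile> y)" for x y z
    using diff_in_diff_span[of "x \<turnstile> y" z] by (intro eq) (simp add: right_commutative_vdash)
  show ?thesis
  proof unfold_locales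
    show "bilinear_op (pair_scale scale) (\<lambda>u v. (\<pi> (fst u \<turnstile> fst v), fst u \<turnstile> snd v + snd u \<stileturn> fst v))"
      by (auto simp: p.bilinear_op_iff pair_scale_def vdash_simps dashv_simps P.add P.scale scale_right_distrib)
  next
    fix x y z :: "'n \<times> 'n"
    obtain a m where x: "x = (a, m)" by (cases x)
    obtain b n where y: "y = (b, n)" by (cases y)
    obtain c r where z: "z = (c, r)" by (cases z)
    let ?m = "\<lambda>u v. (\<pi> (fst u \<turnstile> fst v), fst u \<turnstile> snd v + snd u \<stileturn> fst v)"
    have 4: "\<pi> ((a \<turnstile> b) \<turnstile> c) - \<pi> (a \<turnstile> (b \<turnstile> c)) = \<pi> ((b \<turnstile> a) \<turnstile> c) - \<pi> (b \<turnstile> (a \<turnstile> c))"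
      using arg_cong[OF left_symmetric_vdash[of a b c], of \<pi>] by (simp add: P.diff)
    have 5: "(m \<stileturn> b) \<stileturn> c - m \<stileturn> (b \<turnstile> c) = (b \<turnstile> m) \<stileturn> c - b \<turnstile> (m \<stileturn> c)" for m b c
      using left_symmetric_dashv[of m b c] by (simp add: zero_dashv)
    \<comment> \<open>The second component of the associator, sorted by which factor contributes its
      module part. The first group is symmetric in \<open>a\<close> and \<open>b\<close>; exchanging
      \<open>x\<close> and \<open>y\<close> swaps the other two groups.\<close>
    have 6: "(a \<turnstile> b) \<turnstile> r + (a \<turnstile> n + m \<stileturn> b) \<stileturn> c - (a \<turnstile> (b \<turnstile> r + n \<stileturn> c) + m \<stileturn> (b \<turnstile> c))
      = ((a \<turnstile> b) \<turnstile> r - a \<turnstile> (b \<turnstile> r)) + ((a \<turnstile> n) \<stileturn> c - a \<turnstile> (n \<stileturn> c))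
        + ((b \<turnstile> m) \<stileturn> c - b \<turnstile> (m \<stileturn> c))" for a b m n
      by (simp add: 5[symmetric] vdash_simps dashv_simps)
    have 7: "(a \<turnstile> b) \<turnstile> r + (a \<turnstile> n + m \<stileturn> b) \<stileturn> c - (a \<turnstile> (b \<turnstile> r + n \<stileturn> c) + m \<stileturn> (b \<turnstile> c))
      = (b \<turnstile> a) \<turnstile> r + (b \<turnstile> m + n \<stileturn> a) \<stileturn> c - (b \<turnstile> (a \<turnstile> r + m \<stileturn> c) + n \<stileturn> (a \<turnstile> c))"
      unfolding 6 left_symmetric_vdash[of a b r] by (simp only: ac_simps)
    show "?m (?m x y) z - ?m x (?m y z) = ?m (?m y x) z - ?m y (?m x z)"
      using 4 7 by (simp add: x y z 1 2)
    show "?m (?m x y) z = ?m (?m x z) y"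
      using right_commutative_vdash[of a n c] right_commutative_vdash[of a r b] right_commutative_dashv[of m b c]
      by (simp add: x y z 1 3[of a b c] dashv_simps algebra_simps)
  qed
qed

theorem embeds_in_differential_perm_algebra:
  "\<exists>(scaleP :: 'k \<Rightarrow> ('n, 'k) envelope \<Rightarrow> ('n, 'k) envelope) mult d \<theta>.
    differential_perm_algebra scaleP mult d \<and> Vector_Spaces.linear scale scaleP \<theta> \<and> inj \<theta> \<and>
    (\<forall>x y. \<theta> (x \<turnstile> y) = mult (\<theta> x) (d (\<theta> y))) \<and>
    (\<forall>x y. \<theta> (x \<stileturn> y) = mult (d (\<theta> y)) (\<theta> x))"
proof -
  have "subspace diff_span" unfolding diff_span_def by (rule subspace_span)
  then obtain \<pi> where "Vector_Spaces.linear scale scale \<pi> \<and> (\<forall>x. \<pi> x = 0 \<longleftrightarrow> x \<in> diff_span)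
      \<and> (\<forall>x. x - \<pi> x \<in> diff_span)"
    using exists_projection by blast
  then have \<pi>: "Vector_Spaces.linear scale scale \<pi>" "\<And>x. \<pi> x = 0 \<longleftrightarrow> x \<in> diff_span"
    "\<And>x. x - \<pi> x \<in> diff_span" by auto
  interpret P: Vector_Spaces.linear scale scale \<pi> by (rule \<pi>(1))
  interpret N: novikov_algebra "pair_scale scale"
      "\<lambda>u v. (\<pi> (fst u \<turnstile> fst v), fst u \<turnstile> snd v + snd u \<stileturn> fst v)"
    by (rule split_null_extension[OF \<pi>])
  obtain mult d and j :: "'n \<times> 'n \<Rightarrow> (nat \<times> (('n \<times> 'n) multiset \<Rightarrow> 'n \<times> 'n)) multiset \<Rightarrow>\<^sub>0 'k"
    where C: "differential_comm_algebra pscale mult d"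
      and lj: "Vector_Spaces.linear (pair_scale scale) pscale j" and inj: "inj j"
      and j': "\<forall>u v. j (\<pi> (fst u \<turnstile> fst v), fst u \<turnstile> snd v + snd u \<stileturn> fst v) = mult (j u) (d (j v))"
    using N.embeds_in_differential_comm_algebra by (elim exE conjE)
  have j: "mult (j u) (d (j v)) = j (\<pi> (fst u \<turnstile> fst v), fst u \<turnstile> snd v + snd u \<stileturn> fst v)" for u v
    using j' by simp
  interpret C: differential_comm_algebra pscale mult d by (rule C)
  interpret PA: differential_perm_algebra "pair_scale pscale"
      "\<lambda>u v. (mult (fst u) (fst v), mult (fst u) (snd v))" "\<lambda>u. (d (fst u), d (snd u))"
    by (rule C.differential_perm_algebra_pair)
  interpret j: Vector_Spaces.linear "pair_scale scale" pscale j by (rule lj)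
  have 1: "\<pi> x \<turnstile> y = x \<turnstile> y" "y \<stileturn> \<pi> x = y \<stileturn> x" for x y
    using diff_span_annihilates[OF \<pi>(3)[of x], of y] by (simp_all add: vdash_simps dashv_simps)
  have 2: "\<pi> (x \<turnstile> \<pi> y) = \<pi> (x \<turnstile> y)" for x y
    using vdash_diff_span[OF \<pi>(3)[of y], of x] \<pi>(2)[of "x \<turnstile> y - x \<turnstile> \<pi> y"] by (simp add: vdash_simps P.diff)
  have 3: "\<pi> (x \<stileturn> y) = \<pi> (x \<turnstile> y)" for x y
    using diff_in_diff_span[of x y] \<pi>(2)[of "x \<turnstile> y - x \<stileturn> y"] by (simp add: P.diff)
  \<comment> \<open>The first component records how \<open>x\<close> acts on the module, the second
    \<open>x\<close> itself; the latter alone gives injectivity.\<close>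
  let ?\<theta> = "\<lambda>x. (j (\<pi> x, 0), j (0, x))"
  have "Vector_Spaces.linear scale (pair_scale pscale) ?\<theta>"
    using j.add[of "(\<pi> x, 0)" "(\<pi> y, 0)" for x y] j.add[of "(0, x)" "(0, y)" for x y]
      j.scale[of _ "(\<pi> x, 0)" for x] j.scale[of _ "(0, x)" for x]
    by (simp add: Vector_Spaces.linear_iff vector_space_axioms PA.vector_space_axioms P.add P.scale)
  moreover have "inj ?\<theta>"
    by (auto intro!: injI dest: injD[OF inj])
  moreover have "?\<theta> (x \<turnstile> y) = (mult (fst (?\<theta> x)) (fst (d (fst (?\<theta> y)), d (snd (?\<theta> y)))),
      mult (fst (?\<theta> x)) (snd (d (fst (?\<theta> y)), d (snd (?\<theta> y)))))" for x y
    by (simp add: j 1 2 vdash_simps dashv_simps)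
  \<comment> \<open>Commuting the factors in the second component gives
    \<open>mult (j (0, x)) (d (j (\<pi> y, 0)))\<close>, the right action of \<open>y\<close> on
    \<open>x\<close>; in the first, \<stileturn> and \<turnstile> agree under
    \<open>\<pi>\<close>.\<close>
  moreover have "?\<theta> (x \<stileturn> y) = (mult (fst (d (fst (?\<theta> y)), d (snd (?\<theta> y)))) (fst (?\<theta> x)),
      mult (fst (d (fst (?\<theta> y)), d (snd (?\<theta> y)))) (snd (?\<theta> x)))" for x y
    by (simp add: C.comm[of "d u" for u] j 1 2 3 vdash_simps dashv_simps)
  ultimately show ?thesis
    by (rule PA.transfer_to_envelope)
qed

end

theorem theorem1:
  fixes scale :: "'k::field \<Rightarrow> 'n::ab_group_add \<Rightarrow> 'n"
    and vdash dashv :: "'n \<Rightarrow> 'n \<Rightarrow> 'n"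
  assumes "novikov_dialgebra scale vdash dashv"
  shows "\<exists>(scaleP :: 'k \<Rightarrow> ('n, 'k) envelope \<Rightarrow> ('n, 'k) envelope)
            (mult :: ('n, 'k) envelope \<Rightarrow> ('n, 'k) envelope \<Rightarrow> ('n, 'k) envelope)
            (d :: ('n, 'k) envelope \<Rightarrow> ('n, 'k) envelope)
            (\<theta> :: 'n \<Rightarrow> ('n, 'k) envelope).
           differential_perm_algebra scaleP mult d \<and>
           Vector_Spaces.linear scale scaleP \<theta> \<and> inj \<theta> \<and>
           (\<forall>x y. \<theta> (vdash x y) = mult (\<theta> x) (d (\<theta> y))) \<and>
           (\<forall>x y. \<theta> (dashv x y) = mult (d (\<theta> y)) (\<theta> x))"
  using assms by (rule novikov_dialgebra.embeds_in_differential_perm_algebra)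

end
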